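(* Let $k$ be a commutative ring and $\mathcal{A}$ a unital commutative $k$-algebra with $\varepsilon(\mathcal{A})\neq0$. Let $\{\cdot,\cdot\}$ be a $k$-bilinear biderivation on $\mathcal{A}$, let $\tilde\pi:\Omega^1_{\mathcal{A}|k}\to\mathrm{Der}(\mathcal{A})$ be the unique $\mathcal{A}$-linear map with $\tilde\pi(da)=\{a,\cdot\}$ for all $a\in\mathcal{A}$, and let $L_\pi=\{(\tilde\pi(\alpha),\alpha):\alpha\in\Omega^1_{\mathcal{A}|k}\}\subset E(\mathcal{A})$. Then $\{\cdot,\cdot\}$ is a Poisson bracket if and only if $p(L_\pi)$ is a Dirac structure on $\mathcal{A}$, where $p:E(\mathcal{A})\to\varepsilon(\mathcal{A})$ is the canonical projection.
   Context: For a unital commutative $k$-algebra $\mathcal{A}$, let $\mathrm{Der}(\mathcal{A})$ be the $k$-linear derivations of $\mathcal{A}$ (equal to the first Hochschild cohomology $H^1(\mathcal{A},\mathcal{A})$) and $\Omega^1_{\mathcal{A}|k}$ the module of Kähler differentials with universal derivation $d$ (isomorphic to the first Hochschild homology $H_1(\mathcal{A},\mathcal{A})$ via $a_0\otimes a_1\leftrightarrow a_0\,da_1$). Put $E(\mathcal{A})=\mathrm{Der}(\mathcal{A})\oplus\Omega^1_{\mathcal{A}|k}$, with pairing $\langle X,a\,db\rangle=aX(b)\in\mathcal{A}$, Lie derivative $\mathcal{L}_X(a\,db)=X(a)\,db+a\,d(X(b))$, Courant bracket $[\![(X_1,\alpha_1),(X_2,\alpha_2)]\!]=([X_1,X_2],\mathcal{L}_{X_1}\alpha_2-\mathcal{L}_{X_2}\alpha_1+d\langle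 X_2,\alpha_1\rangle)$, and symmetric $\mathcal{A}$-valued bilinear form $((X_1,\alpha_1),(X_2,\alpha_2))=\langle X_2,\alpha_1\rangle+\langle X_1,\alpha_2\rangle$. Let $J=\{e\in E(\mathcal{A}):(e,e')=0\ \forall e'\in E(\mathcal{A})\}$, an ideal for the Courant bracket, and $\varepsilon(\mathcal{A})=E(\mathcal{A})/J$ with the induced Courant bracket and induced nondegenerate bilinear form. A submodule $L\subset\varepsilon(\mathcal{A})$ is isotropic if the form vanishes on $L\times L$; an isotropic $L$ is maximally isotropic if every $e\in\varepsilon(\mathcal{A})$ with $(e,l)=0$ for all $l\in L$ lies in $L$. A Dirac structure on $\mathcal{A}$ is a maximally isotropic submodule of $\varepsilon(\mathcal{A})$ closed under the induced Courant bracket. A biderivation is a map $\mathcal{A}\times\mathcal{A}\to\mathcal{A}$ that is a derivation in each argument. A Poisson bracket is a $k$-bilinear biderivation that is skew-symmetric ($\{a,b\}=-\{b,a\}$) and satisfies the Jacobi identity. *)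

theory Defs
  imports "HOL-Algebra.Module" "HOL-Algebra.QuotRing"
begin

text \<open>
  A $k$-algebra is an instance of the library locale \<^locale>\<open>algebra\<close>. Modules are
  \<^typ>\<open>('a, 'm) module\<close> records whose multiplicative fields are left \<^term>\<open>undefined\<close>; maps defined
  on the algebra are extensional, so that equality of elements is equality of maps on the carrier.
\<close>

section \<open>Generalities on modules\<close>

definition linear_maps ::
  "('a, 'r) ring_scheme \<Rightarrow> ('a, 'm, 'u) module_scheme \<Rightarrow> ('a, 'n, 'v) module_scheme \<Rightarrow> ('m \<Rightarrow> 'n) set"
  where "linear_maps R M N =
    {h \<in> carrier M \<rightarrow> carrier N.
       (\<forall>x\<in>carrier M. \<forall>y\<in>carrier M. h (x \<oplus>\<^bsub>M\<^esub> y) = h x \<oplus>\<^bsub>N\<^esub> h y) \<and>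
       (\<forall>a\<in>carrier R. \<forall>x\<in>carrier M. h (a \<odot>\<^bsub>M\<^esub> x) = a \<odot>\<^bsub>N\<^esub> h x)}"

definition submodule_generated ::
  "('a, 'r) ring_scheme \<Rightarrow> ('a, 'm, 'u) module_scheme \<Rightarrow> 'm set \<Rightarrow> 'm set"
  where "submodule_generated R M S = \<Inter>{H. submodule H R M \<and> S \<subseteq> H}"

text \<open>The elements of the quotient module are cosets; compare \<^const>\<open>FactRing\<close>.\<close>

definition quotient_module :: "('a, 'm, 'u) module_scheme \<Rightarrow> 'm set \<Rightarrow> ('a, 'm set) module"
  where "quotient_module M N =
    \<lparr>carrier = a_rcosets\<^bsub>M\<^esub> N, mult = undefined, one = undefined, zero = N, add = set_add M,
     smult = (\<lambda>a U. \<Union>x\<in>U. N +>\<^bsub>M\<^esub> (a \<odot>\<^bsub>M\<^esub> x))\<rparr>"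

definition direct_sum ::
  "('a, 'm, 'u) module_scheme \<Rightarrow> ('a, 'n, 'v) module_scheme \<Rightarrow> ('a, 'm \<times> 'n) module"
  where "direct_sum M N =
    \<lparr>carrier = carrier M \<times> carrier N, mult = undefined, one = undefined,
     zero = (\<zero>\<^bsub>M\<^esub>, \<zero>\<^bsub>N\<^esub>),
     add = (\<lambda>(x, y) (x', y'). (x \<oplus>\<^bsub>M\<^esub> x', y \<oplus>\<^bsub>N\<^esub> y')),
     smult = (\<lambda>a (x, y). (a \<odot>\<^bsub>M\<^esub> x, a \<odot>\<^bsub>N\<^esub> y))\<rparr>"


section \<open>Derivations\<close>

definition derivations :: "('k, 'c) ring_scheme \<Rightarrow> ('k, 'a, 'd) module_scheme \<Rightarrow> ('a \<Rightarrow> 'a) set"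
  where "derivations k A =
    {X \<in> carrier A \<rightarrow>\<^sub>E carrier A.
       (\<forall>a\<in>carrier A. \<forall>b\<in>carrier A. X (a \<oplus>\<^bsub>A\<^esub> b) = X a \<oplus>\<^bsub>A\<^esub> X b) \<and>
       (\<forall>c\<in>carrier k. \<forall>a\<in>carrier A. X (c \<odot>\<^bsub>A\<^esub> a) = c \<odot>\<^bsub>A\<^esub> X a) \<and>
       (\<forall>a\<in>carrier A. \<forall>b\<in>carrier A.
          X (a \<otimes>\<^bsub>A\<^esub> b) = (X a \<otimes>\<^bsub>A\<^esub> b) \<oplus>\<^bsub>A\<^esub> (a \<otimes>\<^bsub>A\<^esub> X b))}"

definition Der :: "('k, 'c) ring_scheme \<Rightarrow> ('k, 'a, 'd) module_scheme \<Rightarrow> ('a, 'a \<Rightarrow> 'a) module"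
  where "Der k A =
    \<lparr>carrier = derivations k A, mult = undefined, one = undefined,
     zero = (\<lambda>b\<in>carrier A. \<zero>\<^bsub>A\<^esub>),
     add = (\<lambda>X Y. \<lambda>b\<in>carrier A. X b \<oplus>\<^bsub>A\<^esub> Y b),
     smult = (\<lambda>a X. \<lambda>b\<in>carrier A. a \<otimes>\<^bsub>A\<^esub> X b)\<rparr>"

definition commutator :: "('a, 'c) ring_scheme \<Rightarrow> ('a \<Rightarrow> 'a) \<Rightarrow> ('a \<Rightarrow> 'a) \<Rightarrow> 'a \<Rightarrow> 'a"
  where "commutator A X Y = (\<lambda>b\<in>carrier A. X (Y b) \<ominus>\<^bsub>A\<^esub> Y (X b))"


section \<open>Kaehler differentials\<close>

text \<open>
  $\Omega^1_{A|k}$ is the free $A$-module on symbols $[b]$, $b \in A$, modulo the relations making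
  $b \mapsto [b]$ a $k$-linear derivation. An element of the free module is its finitely supported
  coefficient function.
\<close>

definition free_module :: "('a, 'c) ring_scheme \<Rightarrow> ('a, 'a \<Rightarrow> 'a) module"
  where "free_module A =
    \<lparr>carrier = {f \<in> carrier A \<rightarrow>\<^sub>E carrier A. finite {b \<in> carrier A. f b \<noteq> \<zero>\<^bsub>A\<^esub>}},
     mult = undefined, one = undefined,
     zero = (\<lambda>b\<in>carrier A. \<zero>\<^bsub>A\<^esub>),
     add = (\<lambda>f g. \<lambda>b\<in>carrier A. f b \<oplus>\<^bsub>A\<^esub> g b),
     smult = (\<lambda>a f. \<lambda>b\<in>carrier A. a \<otimes>\<^bsub>A\<^esub> f b)\<rparr>"

definition free_gen :: "('a, 'c) ring_scheme \<Rightarrow> 'a \<Rightarrow> 'a \<Rightarrow> 'a"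
  where "free_gen A b = (\<lambda>x\<in>carrier A. if x = b then \<one>\<^bsub>A\<^esub> else \<zero>\<^bsub>A\<^esub>)"

text \<open>A scalar $c \in k$ acts on an $A$-module as $c \cdot 1 \in A$.\<close>

definition kaehler_relations ::
  "('k, 'c) ring_scheme \<Rightarrow> ('k, 'a, 'd) module_scheme \<Rightarrow> ('a \<Rightarrow> 'a) set"
  where "kaehler_relations k A = (let F = free_module A; g = free_gen A in
    {g (a \<oplus>\<^bsub>A\<^esub> b) \<ominus>\<^bsub>F\<^esub> (g a \<oplus>\<^bsub>F\<^esub> g b) | a b. a \<in> carrier A \<and> b \<in> carrier A} \<union>
    {g (c \<odot>\<^bsub>A\<^esub> a) \<ominus>\<^bsub>F\<^esub> ((c \<odot>\<^bsub>A\<^esub> \<one>\<^bsub>A\<^esub>) \<odot>\<^bsub>F\<^esub> g a) | c a. c \<in> carrier k \<and> a \<in> carrier A} \<union>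
    {g (a \<otimes>\<^bsub>A\<^esub> b) \<ominus>\<^bsub>F\<^esub> ((b \<odot>\<^bsub>F\<^esub> g a) \<oplus>\<^bsub>F\<^esub> (a \<odot>\<^bsub>F\<^esub> g b)) | a b.
       a \<in> carrier A \<and> b \<in> carrier A})"

definition kaehler_null :: "('k, 'c) ring_scheme \<Rightarrow> ('k, 'a, 'd) module_scheme \<Rightarrow> ('a \<Rightarrow> 'a) set"
  where "kaehler_null k A = submodule_generated A (free_module A) (kaehler_relations k A)"

definition Kaehler ::
  "('k, 'c) ring_scheme \<Rightarrow> ('k, 'a, 'd) module_scheme \<Rightarrow> ('a, ('a \<Rightarrow> 'a) set) module"
  where "Kaehler k A = quotient_module (free_module A) (kaehler_null k A)"

definition univ_d ::
  "('k, 'c) ring_scheme \<Rightarrow> ('k, 'a, 'd) module_scheme \<Rightarrow> 'a \<Rightarrow> ('a \<Rightarrow> 'a) set"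
  where "univ_d k A b = kaehler_null k A +>\<^bsub>free_module A\<^esub> free_gen A b"

text \<open>
  The additive map on $\Omega^1_{A|k}$ with values in \<open>M\<close> that is given on generators by
  $a\,db \mapsto h(a, b)$; it is used only for \<open>h\<close> for which the value below does not depend on the
  representative \<open>f\<close> of \<open>\<alpha>\<close>.
\<close>

definition kaehler_lift ::
  "('a, 'c) ring_scheme \<Rightarrow> ('m, 'd) ring_scheme \<Rightarrow> ('a \<Rightarrow> 'a \<Rightarrow> 'm) \<Rightarrow> ('a \<Rightarrow> 'a) set \<Rightarrow> 'm"
  where "kaehler_lift A M h \<alpha> =
    the_elem ((\<lambda>f. \<Oplus>\<^bsub>M\<^esub>b\<in>{b \<in> carrier A. f b \<noteq> \<zero>\<^bsub>A\<^esub>}. h (f b) b) ` \<alpha>)"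

definition pairing :: "('a, 'c) ring_scheme \<Rightarrow> ('a \<Rightarrow> 'a) \<Rightarrow> ('a \<Rightarrow> 'a) set \<Rightarrow> 'a"
  where "pairing A X = kaehler_lift A A (\<lambda>a b. a \<otimes>\<^bsub>A\<^esub> X b)"

definition lie_derivative ::
  "('k, 'c) ring_scheme \<Rightarrow> ('k, 'a, 'd) module_scheme \<Rightarrow> ('a \<Rightarrow> 'a) \<Rightarrow> ('a \<Rightarrow> 'a) set \<Rightarrow> ('a \<Rightarrow> 'a) set"
  where "lie_derivative k A X = kaehler_lift A (Kaehler k A)
    (\<lambda>a b. (X a \<odot>\<^bsub>Kaehler k A\<^esub> univ_d k A b) \<oplus>\<^bsub>Kaehler k A\<^esub> (a \<odot>\<^bsub>Kaehler k A\<^esub> univ_d k A (X b)))"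


section \<open>The modules \<open>E(A)\<close> and \<open>\<epsilon>(A)\<close>\<close>

type_synonym 'a courant = "('a \<Rightarrow> 'a) \<times> ('a \<Rightarrow> 'a) set"

definition E_module :: "('k, 'c) ring_scheme \<Rightarrow> ('k, 'a, 'd) module_scheme \<Rightarrow> ('a, 'a courant) module"
  where "E_module k A = direct_sum (Der k A) (Kaehler k A)"

definition E_bracket ::
  "('k, 'c) ring_scheme \<Rightarrow> ('k, 'a, 'd) module_scheme \<Rightarrow> 'a courant \<Rightarrow> 'a courant \<Rightarrow> 'a courant"
  where "E_bracket k A = (\<lambda>(X\<^sub>1, \<alpha>\<^sub>1) (X\<^sub>2, \<alpha>\<^sub>2).
    (commutator A X\<^sub>1 X\<^sub>2,
     (lie_derivative k A X\<^sub>1 \<alpha>\<^sub>2 \<ominus>\<^bsub>Kaehler k A\<^esub> lie_derivative k A X\<^sub>2 \<alpha>\<^sub>1)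
       \<oplus>\<^bsub>Kaehler k A\<^esub> univ_d k A (pairing A X\<^sub>2 \<alpha>\<^sub>1)))"

definition E_form :: "('a, 'c) ring_scheme \<Rightarrow> 'a courant \<Rightarrow> 'a courant \<Rightarrow> 'a"
  where "E_form A = (\<lambda>(X\<^sub>1, \<alpha>\<^sub>1) (X\<^sub>2, \<alpha>\<^sub>2). pairing A X\<^sub>2 \<alpha>\<^sub>1 \<oplus>\<^bsub>A\<^esub> pairing A X\<^sub>1 \<alpha>\<^sub>2)"

definition J_ideal :: "('k, 'c) ring_scheme \<Rightarrow> ('k, 'a, 'd) module_scheme \<Rightarrow> 'a courant set"
  where "J_ideal k A =
    {e \<in> carrier (E_module k A). \<forall>e'\<in>carrier (E_module k A). E_form A e e' = \<zero>\<^bsub>A\<^esub>}"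

definition eps_module ::
  "('k, 'c) ring_scheme \<Rightarrow> ('k, 'a, 'd) module_scheme \<Rightarrow> ('a, 'a courant set) module"
  where "eps_module k A = quotient_module (E_module k A) (J_ideal k A)"

definition eps_proj ::
  "('k, 'c) ring_scheme \<Rightarrow> ('k, 'a, 'd) module_scheme \<Rightarrow> 'a courant \<Rightarrow> 'a courant set"
  where "eps_proj k A e = J_ideal k A +>\<^bsub>E_module k A\<^esub> e"

text \<open>
  The induced operations: apply the operation of \<open>E(A)\<close> to all representatives, and take the unique
  value that results.
\<close>

definition eps_bracket ::
  "('k, 'c) ring_scheme \<Rightarrow> ('k, 'a, 'd) module_scheme \<Rightarrow>
   'a courant set \<Rightarrow> 'a courant set \<Rightarrow> 'a courant set"
  where "eps_bracket k A U V =
    the_elem ((\<lambda>(u, v). eps_proj k A (E_bracket k A u v)) ` (U \<times> V))"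

definition eps_form :: "('a, 'c) ring_scheme \<Rightarrow> 'a courant set \<Rightarrow> 'a courant set \<Rightarrow> 'a"
  where "eps_form A U V = the_elem ((\<lambda>(u, v). E_form A u v) ` (U \<times> V))"


section \<open>Dirac structures\<close>

definition isotropic ::
  "('k, 'c) ring_scheme \<Rightarrow> ('k, 'a, 'd) module_scheme \<Rightarrow> 'a courant set set \<Rightarrow> bool"
  where "isotropic k A L \<longleftrightarrow>
    submodule L A (eps_module k A) \<and> (\<forall>l\<in>L. \<forall>l'\<in>L. eps_form A l l' = \<zero>\<^bsub>A\<^esub>)"

definition maximally_isotropic ::
  "('k, 'c) ring_scheme \<Rightarrow> ('k, 'a, 'd) module_scheme \<Rightarrow> 'a courant set set \<Rightarrow> bool"
  where "maximally_isotropic k A L \<longleftrightarrow>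
    isotropic k A L \<and>
    (\<forall>e\<in>carrier (eps_module k A). (\<forall>l\<in>L. eps_form A e l = \<zero>\<^bsub>A\<^esub>) \<longrightarrow> e \<in> L)"

definition dirac_structure ::
  "('k, 'c) ring_scheme \<Rightarrow> ('k, 'a, 'd) module_scheme \<Rightarrow> 'a courant set set \<Rightarrow> bool"
  where "dirac_structure k A L \<longleftrightarrow>
    maximally_isotropic k A L \<and> (\<forall>l\<in>L. \<forall>l'\<in>L. eps_bracket k A l l' \<in> L)"


section \<open>Poisson brackets\<close>

definition k_bilinear ::
  "('k, 'c) ring_scheme \<Rightarrow> ('k, 'a, 'd) module_scheme \<Rightarrow> ('a \<Rightarrow> 'a \<Rightarrow> 'a) \<Rightarrow> bool"
  where "k_bilinear k A br \<longleftrightarrow>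
    (\<forall>a\<in>carrier A. (\<lambda>b. br a b) \<in> linear_maps k A A) \<and>
    (\<forall>b\<in>carrier A. (\<lambda>a. br a b) \<in> linear_maps k A A)"

definition biderivation ::
  "('k, 'c) ring_scheme \<Rightarrow> ('k, 'a, 'd) module_scheme \<Rightarrow> ('a \<Rightarrow> 'a \<Rightarrow> 'a) \<Rightarrow> bool"
  where "biderivation k A br \<longleftrightarrow>
    (\<forall>a\<in>carrier A. (\<lambda>b\<in>carrier A. br a b) \<in> derivations k A) \<and>
    (\<forall>b\<in>carrier A. (\<lambda>a\<in>carrier A. br a b) \<in> derivations k A)"

definition poisson_bracket ::
  "('k, 'c) ring_scheme \<Rightarrow> ('k, 'a, 'd) module_scheme \<Rightarrow> ('a \<Rightarrow> 'a \<Rightarrow> 'a) \<Rightarrow> bool"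
  where "poisson_bracket k A br \<longleftrightarrow>
    k_bilinear k A br \<and> biderivation k A br \<and>
    (\<forall>a\<in>carrier A. \<forall>b\<in>carrier A. br a b = \<ominus>\<^bsub>A\<^esub> br b a) \<and>
    (\<forall>a\<in>carrier A. \<forall>b\<in>carrier A. \<forall>c\<in>carrier A.
       br a (br b c) \<oplus>\<^bsub>A\<^esub> br b (br c a) \<oplus>\<^bsub>A\<^esub> br c (br a b) = \<zero>\<^bsub>A\<^esub>)"

definition L_graph ::
  "('k, 'c) ring_scheme \<Rightarrow> ('k, 'a, 'd) module_scheme \<Rightarrow> (('a \<Rightarrow> 'a) set \<Rightarrow> 'a \<Rightarrow> 'a) \<Rightarrow>
   'a courant set"
  where "L_graph k A pt = (\<lambda>\<alpha>. (pt \<alpha>, \<alpha>)) ` carrier (Kaehler k A)"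

end

theory Submission
  imports Defs
begin

text \<open>
  For a one-form $\alpha$, write $e_\alpha = (\tilde\pi(\alpha), \alpha)$ for the element of the graph
  $L_\pi$ over it. Isotropy of the graph turns out to be skew-symmetry of the bracket, and closure of
  the graph under the Courant bracket to be the Jacobi identity.

  The form is $(e_{da}, e_{db}) = \{a,b\} + \{b,a\}$, so $p(L_\pi)$ is isotropic exactly if the bracket
  is skew-symmetric; the general pair of elements of the graph reduces to this one by bilinearity.
  Maximality is then automatic: if $(X,\alpha)$ is orthogonal to all $e_{db}$, skew-symmetry turns the
  orthogonality relation into $X(b) = \tilde\pi(\alpha)(b)$, so that $(X,\alpha) = e_\alpha$
  (\<open>skew_iff_form_zero\<close>, \<open>graph_maximal\<close>).

  For the Courant bracket one finds $[\![e_{da}, e_{db}]\!] = ([\{a,\cdot\},\{b,\cdot\}], d\{a,b\})$,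
  which lies on the graph exactly if $[\{a,\cdot\},\{b,\cdot\}] = \{\{a,b\},\cdot\}$; given
  skew-symmetry, that is the Jacobi identity. Two points remain.

  \<^item> From exact forms to all forms. The Courant bracket obeys the Leibniz rules
    $[\![e, f e']\!] = f[\![e,e']\!] + X(f) e'$ and
    $[\![f e, e']\!] = f[\![e,e']\!] - X'(f) e + (e,e')\,df$, where \<open>X\<close> and \<open>X'\<close> are the vector field parts
    of \<open>e\<close> and \<open>e'\<close>. The last, anomalous term vanishes on an isotropic submodule, so closure needs to
    be checked on generators only (\<open>graph_closed\<close>).

  \<^item> From $\varepsilon(A)$ back to $E(A)$. The ideal \<open>J\<close> consists of the pairs $(0,\nu)$ with
    $\langle Y,\nu\rangle = 0$ for all \<open>Y\<close>. If $p[\![e_{da},e_{db}]\!] = p(e_\gamma)$, then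
    $d\{a,b\} - \gamma$ is such a form $\nu$, and skew-symmetry gives
    $\tilde\pi(\nu)(c) = -\langle\tilde\pi(dc),\nu\rangle = 0$; so passing to the quotient does not
    weaken the condition (\<open>closed_imp_jacobi\<close>).

  The calculus on $\Omega^1$ rests on \<open>kaehler_lift\<close>: an expression in $a\,db$ that is additive in both
  places and respects the scalar and Leibniz relations defines an additive map on $\Omega^1$. Additive
  maps, rather than linear ones, are what is needed to include the Lie derivative. All further
  identities are checked on the generators $a\,db$ by \<open>kaehler_induct\<close>.
\<close>

section \<open>Modules, quotients and additive maps\<close>

lemma (in module) smult_r_diff:
  "a \<in> carrier R \<Longrightarrow> x \<in> carrier M \<Longrightarrow> y \<in> carrier M \<Longrightarrow>
    a \<odot>\<^bsub>M\<^esub> (x \<ominus>\<^bsub>M\<^esub> y) = a \<odot>\<^bsub>M\<^esub> x \<ominus>\<^bsub>M\<^esub> a \<odot>\<^bsub>M\<^esub> y"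
  by (simp add: a_minus_def smult_r_distr smult_r_minus)

lemma (in abelian_group_hom) hom_diff:
  "x \<in> carrier G \<Longrightarrow> y \<in> carrier G \<Longrightarrow> h (x \<ominus>\<^bsub>G\<^esub> y) = h x \<ominus>\<^bsub>H\<^esub> h y"
  by (simp add: a_minus_def)

lemma (in abelian_group) diff_eq_zero_iff:
  "x \<in> carrier G \<Longrightarrow> y \<in> carrier G \<Longrightarrow> x \<ominus> y = \<zero> \<longleftrightarrow> x = y"
  by (metis a_minus_def add.inv_closed minus_equality minus_minus r_neg)

context module
begin

lemma submodule_criterion:
  assumes "H \<subseteq> carrier M" "\<zero>\<^bsub>M\<^esub> \<in> H"
    and "\<And>x y. x \<in> H \<Longrightarrow> y \<in> H \<Longrightarrow> x \<oplus>\<^bsub>M\<^esub> y \<in> H"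
    and smult: "\<And>a x. a \<in> carrier R \<Longrightarrow> x \<in> H \<Longrightarrow> a \<odot>\<^bsub>M\<^esub> x \<in> H"
  shows "submodule H R M"
proof (rule submoduleI)
  fix x assume x: "x \<in> H"
  with assms(1) have "\<ominus>\<^bsub>M\<^esub> x = (\<ominus> \<one>) \<odot>\<^bsub>M\<^esub> x" by (simp add: smult_l_minus subset_iff)
  then show "\<ominus>\<^bsub>M\<^esub> x \<in> H"
    using smult[of "\<ominus> \<one>" x] x by simp
qed (use assms in auto)

lemma submodule_generated_is_submodule:
  assumes "S \<subseteq> carrier M"
  shows "submodule (submodule_generated R M S) R M"
proof (rule submodule_criterion)
  show "submodule_generated R M S \<subseteq> carrier M"
    using carrier_is_submodule assms by (auto simp: submodule_generated_def)
  show "\<zero>\<^bsub>M\<^esub> \<in> submodule_generated R M S"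
    by (auto simp: submodule_generated_def intro: subgroup.one_closed[OF submodule.axioms(1), simplified])
qed (auto simp: submodule_generated_def submoduleE(4,5))

text \<open>
  The set of all \<open>x\<close> with \<open>\<Phi> (c x) = 0\<close> for every scalar \<open>c\<close> is a submodule even though \<open>\<Phi>\<close> is
  only additive. This lets maps such as the Lie derivative, which is additive but not linear, descend
  to a quotient.
\<close>

lemma additive_vanishes_on_generated:
  assumes "abelian_group_hom M N \<Phi>" "S \<subseteq> carrier M"
    and van: "\<And>c s. c \<in> carrier R \<Longrightarrow> s \<in> S \<Longrightarrow> \<Phi> (c \<odot>\<^bsub>M\<^esub> s) = \<zero>\<^bsub>N\<^esub>"
    and x: "x \<in> submodule_generated R M S"
  shows "\<Phi> x = \<zero>\<^bsub>N\<^esub>"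
proof -
  interpret \<Phi>: abelian_group_hom M N \<Phi> by fact
  let ?H = "{x \<in> carrier M. \<forall>c\<in>carrier R. \<Phi> (c \<odot>\<^bsub>M\<^esub> x) = \<zero>\<^bsub>N\<^esub>}"
  have "submodule ?H R M"
    by (rule submodule_criterion) (auto simp: smult_r_distr smult_assoc1[symmetric])
  moreover have "S \<subseteq> ?H" using assms(2) van by auto
  ultimately have "x \<in> ?H" using x unfolding submodule_generated_def by blast
  then have "\<Phi> (\<one> \<odot>\<^bsub>M\<^esub> x) = \<zero>\<^bsub>N\<^esub>" and "x \<in> carrier M" by blast+
  then show ?thesis by simp
qed

end

locale quotient_by_submodule = module R M + N: submodule N R M
  for R :: "('r, 'x) ring_scheme" and M :: "('r, 'm, 'y) module_scheme" (structure) and N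
begin

abbreviation Q where "Q \<equiv> quotient_module M N"

lemma N_subset: "N \<subseteq> carrier M"
  using submoduleE(1)[OF N.submodule_axioms] .

sublocale N: abelian_subgroup N M
  by (rule abelian_subgroupI3[OF additive_subgroup.intro abelian_group_axioms]) (rule N.subgroup_axioms)

lemma carrier_quotient: "carrier Q = (\<lambda>x. N +> x) ` carrier M"
  by (auto simp: quotient_module_def A_RCOSETS_def')

lemma add_quotient:
  "x \<in> carrier M \<Longrightarrow> y \<in> carrier M \<Longrightarrow> (N +> x) \<oplus>\<^bsub>Q\<^esub> (N +> y) = N +> (x \<oplus> y)"
  by (simp add: quotient_module_def N.a_rcos_sum)

lemma zero_quotient: "\<zero>\<^bsub>Q\<^esub> = N +> \<zero>"
  using N_subset by (simp add: quotient_module_def)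

lemma coset_mem: "x \<in> carrier M \<Longrightarrow> y \<in> N +> x \<longleftrightarrow> y \<in> carrier M \<and> y \<ominus> x \<in> N"
proof -
  assume x: "x \<in> carrier M"
  have "y \<in> N +> x \<longleftrightarrow> (\<exists>n\<in>N. y = n \<oplus> x)" by (auto simp: a_r_coset_def')
  also have "\<dots> \<longleftrightarrow> y \<in> carrier M \<and> y \<ominus> x \<in> N"
  proof safe
    fix n assume n: "n \<in> N"
    then show "n \<oplus> x \<in> carrier M" using x N_subset by auto
    show "n \<oplus> x \<ominus> x \<in> N" using n x N_subset
      by (simp add: a_minus_def M.a_assoc M.r_neg subsetD)
  next
    assume "y \<in> carrier M" "y \<ominus> x \<in> N"
    moreover from this x have "y = (y \<ominus> x) \<oplus> x"
      by (simp add: a_minus_def M.a_assoc M.l_neg)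
    ultimately show "\<exists>n\<in>N. y = n \<oplus> x" by blast
  qed
  finally show ?thesis .
qed

lemma coset_eq_iff:
  assumes "x \<in> carrier M" "y \<in> carrier M"
  shows "N +> x = N +> y \<longleftrightarrow> x \<ominus> y \<in> N"
proof
  assume "N +> x = N +> y"
  then have "x \<in> N +> y" using N.a_rcos_self[OF assms(1)] by simp
  then show "x \<ominus> y \<in> N" using coset_mem assms(2) by blast
next
  assume "x \<ominus> y \<in> N"
  then have "x \<in> N +> y" using coset_mem assms by blast
  then show "N +> x = N +> y"
    using a_repr_independence[OF _ assms(2) N.a_subgroup] by simp
qed

lemma smult_quotient:
  assumes c: "c \<in> carrier R" and x: "x \<in> carrier M"
  shows "c \<odot>\<^bsub>Q\<^esub> (N +> x) = N +> (c \<odot> x)"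
proof -
  have "N +> (c \<odot> y) = N +> (c \<odot> x)" if "y \<in> N +> x" for y
  proof -
    have y: "y \<in> carrier M" "y \<ominus> x \<in> N" using that x coset_mem by auto
    have "c \<odot> y \<ominus> c \<odot> x = c \<odot> (y \<ominus> x)"
      using y(1) x c by (simp add: a_minus_def smult_r_distr smult_r_minus)
    with y x c show ?thesis by (simp add: coset_eq_iff)
  qed
  moreover have "x \<in> N +> x" using x by (rule N.a_rcos_self)
  ultimately have "(\<Union>y\<in>N +> x. N +> (c \<odot> y)) = N +> (c \<odot> x)" by blast
  then show ?thesis by (simp add: quotient_module_def)
qed

lemma quotient_is_module: "module R Q"
proof (rule moduleI)
  show "abelian_group Q"
  proof (rule abelian_groupI)
    fix u assume "u \<in> carrier Q"
    then obtain x where x: "x \<in> carrier M" "u = N +> x" by (auto simp: carrier_quotient)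
    then show "\<exists>v\<in>carrier Q. v \<oplus>\<^bsub>Q\<^esub> u = \<zero>\<^bsub>Q\<^esub>"
      by (intro bexI[of _ "N +> (\<ominus> x)"])
        (auto simp: carrier_quotient add_quotient zero_quotient M.l_neg)
  qed (auto simp: carrier_quotient add_quotient zero_quotient M.a_ac)
  show "cring R" by (rule R.is_cring)
next
  fix a b u assume "a \<in> carrier R" "b \<in> carrier R" "u \<in> carrier Q"
  then show "(a \<oplus>\<^bsub>R\<^esub> b) \<odot>\<^bsub>Q\<^esub> u = a \<odot>\<^bsub>Q\<^esub> u \<oplus>\<^bsub>Q\<^esub> b \<odot>\<^bsub>Q\<^esub> u"
    and "(a \<otimes>\<^bsub>R\<^esub> b) \<odot>\<^bsub>Q\<^esub> u = a \<odot>\<^bsub>Q\<^esub> (b \<odot>\<^bsub>Q\<^esub> u)"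
    by (clarsimp simp: carrier_quotient smult_quotient add_quotient smult_l_distr smult_assoc1)+
qed (clarsimp simp: carrier_quotient add_quotient smult_quotient smult_r_distr)+

end

lemma direct_sum_module:
  assumes "module R M" "module R N"
  shows "module R (direct_sum M N)"
proof -
  interpret M: module R M by fact
  interpret N: module R N by fact
  show ?thesis
  proof (rule moduleI)
    show "abelian_group (direct_sum M N)"
    proof (rule abelian_groupI)
      fix u assume "u \<in> carrier (direct_sum M N)"
      then obtain x y where u: "u = (x, y)" "x \<in> carrier M" "y \<in> carrier N"
        by (auto simp: direct_sum_def)
      then show "\<exists>v\<in>carrier (direct_sum M N). v \<oplus>\<^bsub>direct_sum M N\<^esub> u = \<zero>\<^bsub>direct_sum M N\<^esub>"
        by (intro bexI[of _ "(\<ominus>\<^bsub>M\<^esub> x, \<ominus>\<^bsub>N\<^esub> y)"])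
          (auto simp: direct_sum_def M.M.l_neg N.M.l_neg)
    qed (auto simp: direct_sum_def M.M.a_ac N.M.a_ac)
  qed (use M.is_cring in \<open>auto simp: direct_sum_def M.smult_l_distr N.smult_l_distr M.smult_r_distr N.smult_r_distr
      M.smult_assoc1 N.smult_assoc1\<close>)
qed

section \<open>The free module\<close>

text \<open>
  Derivations and finitely supported functions are submodules of the module of all functions on the
  carrier with pointwise operations.
\<close>

definition function_module :: "('a, 'c) ring_scheme \<Rightarrow> ('a, 'a \<Rightarrow> 'a) module"
  where "function_module A =
    \<lparr>carrier = carrier A \<rightarrow>\<^sub>E carrier A, mult = undefined, one = undefined,
     zero = (\<lambda>b\<in>carrier A. \<zero>\<^bsub>A\<^esub>),
     add = (\<lambda>f g. \<lambda>b\<in>carrier A. f b \<oplus>\<^bsub>A\<^esub> g b),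
     smult = (\<lambda>a f. \<lambda>b\<in>carrier A. a \<otimes>\<^bsub>A\<^esub> f b)\<rparr>"

context cring
begin

abbreviation F where "F \<equiv> free_module R"

lemma function_module: "module R (function_module R)"
proof (rule moduleI)
  show "abelian_group (function_module R)"
  proof (rule abelian_groupI)
    fix f assume "f \<in> carrier (function_module R)"
    then show "\<exists>g\<in>carrier (function_module R).
        g \<oplus>\<^bsub>function_module R\<^esub> f = \<zero>\<^bsub>function_module R\<^esub>"
      by (intro bexI[of _ "\<lambda>b\<in>carrier R. \<ominus> f b"])
        (auto simp: function_module_def l_neg PiE_def Pi_def fun_eq_iff)
  qed (auto simp: function_module_def fun_eq_iff a_ac PiE_def Pi_def extensional_def)
qed (auto simp: function_module_def fun_eq_iff is_cring l_distr r_distr m_assoc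
    PiE_def Pi_def extensional_def)

lemma free_module_is_module: "module R F"
proof -
  interpret G: module R "function_module R" by (rule function_module)
  let ?H = "{f \<in> carrier R \<rightarrow>\<^sub>E carrier R. finite {b \<in> carrier R. f b \<noteq> \<zero>}}"
  have "submodule ?H R (function_module R)"
  proof (rule G.submodule_criterion)
    fix f g assume "f \<in> ?H" "g \<in> ?H"
    moreover from this have "finite {b \<in> carrier R. f b \<oplus> g b \<noteq> \<zero>}"
      by (auto intro!: finite_subset[of "{b \<in> carrier R. f b \<oplus> g b \<noteq> \<zero>}"
            "{b \<in> carrier R. f b \<noteq> \<zero>} \<union> {b \<in> carrier R. g b \<noteq> \<zero>}"])
    ultimately show "f \<oplus>\<^bsub>function_module R\<^esub> g \<in> ?H"
      by (auto simp: function_module_def PiE_def Pi_def cong: conj_cong)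
  next
    fix a f assume "a \<in> carrier R" "f \<in> ?H"
    moreover from this have "finite {b \<in> carrier R. a \<otimes> f b \<noteq> \<zero>}"
      by (auto intro!: finite_subset[of "{b \<in> carrier R. a \<otimes> f b \<noteq> \<zero>}" "{b \<in> carrier R. f b \<noteq> \<zero>}"])
    ultimately show "a \<odot>\<^bsub>function_module R\<^esub> f \<in> ?H"
      by (auto simp: function_module_def PiE_def Pi_def cong: conj_cong)
  qed (auto simp: function_module_def cong: conj_cong)
  then have "module R (function_module R\<lparr>carrier := ?H\<rparr>)"
    by (rule submodule.submodule_is_module) (rule function_module)
  then show ?thesis by (simp add: free_module_def function_module_def)
qed

lemma free_gen_closed [simp]: "b \<in> carrier R \<Longrightarrow> free_gen R b \<in> carrier F"
  by (auto simp: free_module_def free_gen_def cong: conj_cong)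

lemma free_module_induct:
  assumes f: "f \<in> carrier F"
    and gen: "\<And>a b. a \<in> carrier R \<Longrightarrow> b \<in> carrier R \<Longrightarrow> P (a \<odot>\<^bsub>F\<^esub> free_gen R b)"
    and add: "\<And>f g. f \<in> carrier F \<Longrightarrow> g \<in> carrier F \<Longrightarrow> P f \<Longrightarrow> P g \<Longrightarrow> P (f \<oplus>\<^bsub>F\<^esub> g)"
  shows "P f"
proof -
  interpret F: module R F by (rule free_module_is_module)
  have "\<forall>f\<in>carrier F. {b \<in> carrier R. f b \<noteq> \<zero>} \<subseteq> S \<longrightarrow> P f" if "finite S" for S
    using that
  proof (induction S)
    case empty
    show ?case
    proof (intro ballI impI)
      fix f assume f: "f \<in> carrier F" "{b \<in> carrier R. f b \<noteq> \<zero>} \<subseteq> {}"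
      then have "f = \<zero> \<odot>\<^bsub>F\<^esub> free_gen R \<zero>"
        by (auto simp: free_module_def free_gen_def fun_eq_iff PiE_def extensional_def)
      then show "P f" using gen[OF zero_closed zero_closed] by (simp only:)
    qed
  next
    case (insert s S)
    show ?case
    proof (intro ballI impI)
      fix f assume f: "f \<in> carrier F" "{b \<in> carrier R. f b \<noteq> \<zero>} \<subseteq> insert s S"
      show "P f"
      proof (cases "s \<in> carrier R")
        case False
        then show ?thesis using insert.IH f by blast
      next
        case True
        \<comment> \<open>Split off the coefficient at \<open>s\<close>; the rest is supported in \<open>S\<close>.\<close>
        define f' where "f' = (\<lambda>b\<in>carrier R. if b = s then \<zero> else f b)"
        have fs: "f b \<in> carrier R" if "b \<in> carrier R" for b
          using f that by (auto simp: free_module_def)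
        have "finite {b \<in> carrier R. f' b \<noteq> \<zero>}"
          using f by (auto simp: f'_def free_module_def elim!: rev_finite_subset)
        then have f': "f' \<in> carrier F" "{b \<in> carrier R. f' b \<noteq> \<zero>} \<subseteq> S"
          using f fs by (auto simp: f'_def free_module_def)
        have "f = f s \<odot>\<^bsub>F\<^esub> free_gen R s \<oplus>\<^bsub>F\<^esub> f'"
          using f(1) fs True
          by (auto simp: f'_def free_module_def free_gen_def fun_eq_iff PiE_def extensional_def)
        moreover have "P f'" using insert.IH f' by blast
        moreover have "f s \<odot>\<^bsub>F\<^esub> free_gen R s \<in> carrier F" "P (f s \<odot>\<^bsub>F\<^esub> free_gen R s)"
          using gen fs True by (simp_all add: F.smult_closed)
        ultimately show ?thesis using add[OF _ f'(1)] by metis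
      qed
    qed
  qed
  then show ?thesis using f by (auto simp: free_module_def)
qed

end

text \<open>
  Evaluation of a finitely supported function, with \<open>h a b\<close> as the value of the generator \<open>b\<close> with
  coefficient \<open>a\<close>. Additivity of \<open>h\<close> in the coefficient makes it vanish at coefficient \<open>0\<close>, hence
  the sum may be taken over any finite set containing the support.
\<close>

locale free_evaluation = cring A + M: abelian_group M
  for A :: "('a, 'c) ring_scheme" and M :: "('m, 'd) ring_scheme" +
  fixes h :: "'a \<Rightarrow> 'a \<Rightarrow> 'm"
  assumes h_closed [simp]: "a \<in> carrier A \<Longrightarrow> b \<in> carrier A \<Longrightarrow> h a b \<in> carrier M"
    and h_add: "a \<in> carrier A \<Longrightarrow> a' \<in> carrier A \<Longrightarrow> b \<in> carrier A \<Longrightarrow>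
      h (a \<oplus>\<^bsub>A\<^esub> a') b = h a b \<oplus>\<^bsub>M\<^esub> h a' b"
begin

sublocale F: module A "free_module A" by (rule free_module_is_module)

definition \<Phi> :: "('a \<Rightarrow> 'a) \<Rightarrow> 'm"
  where "\<Phi> f = (\<Oplus>\<^bsub>M\<^esub>b\<in>{b \<in> carrier A. f b \<noteq> \<zero>\<^bsub>A\<^esub>}. h (f b) b)"

lemma h_zero [simp]: "b \<in> carrier A \<Longrightarrow> h \<zero>\<^bsub>A\<^esub> b = \<zero>\<^bsub>M\<^esub>"
  using h_add[of "\<zero>\<^bsub>A\<^esub>" "\<zero>\<^bsub>A\<^esub>" b] M.add.l_cancel_one[of "h \<zero>\<^bsub>A\<^esub> b" "h \<zero>\<^bsub>A\<^esub> b"]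
  by simp

lemma \<Phi>_superset:
  assumes "f \<in> carrier F" "finite S" "{b \<in> carrier A. f b \<noteq> \<zero>\<^bsub>A\<^esub>} \<subseteq> S" "S \<subseteq> carrier A"
  shows "\<Phi> f = (\<Oplus>\<^bsub>M\<^esub>b\<in>S. h (f b) b)"
  unfolding \<Phi>_def
proof (rule M.add.finprod_mono_neutral_cong_left)
  have "f \<in> carrier A \<rightarrow> carrier A" using assms by (auto simp: free_module_def)
  then show "(\<lambda>b. h (f b) b) \<in> S \<rightarrow> carrier M" using assms(4) by (auto intro!: h_closed)
  fix b assume "b \<in> S - {b \<in> carrier A. f b \<noteq> \<zero>\<^bsub>A\<^esub>}"
  then have "b \<in> carrier A" "f b = \<zero>\<^bsub>A\<^esub>" using assms(4) by auto
  then show "h (f b) b = \<zero>\<^bsub>M\<^esub>" by simp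
qed (use assms in auto)

sublocale \<Phi>: abelian_group_hom F M \<Phi>
proof (rule abelian_group_homI)
  show "abelian_group F" "abelian_group M"
    using F.abelian_group_axioms M.abelian_group_axioms by auto
  have "\<Phi> f \<in> carrier M" if "f \<in> carrier F" for f
  proof -
    have "f \<in> carrier A \<rightarrow> carrier A" using that by (auto simp: free_module_def)
    then show ?thesis unfolding \<Phi>_def by (intro M.finsum_closed) (simp add: Pi_def)
  qed
  moreover have "\<Phi> (f \<oplus>\<^bsub>F\<^esub> g) = \<Phi> f \<oplus>\<^bsub>M\<^esub> \<Phi> g" if fg: "f \<in> carrier F" "g \<in> carrier F" for f g
  proof -
    let ?S = "{b \<in> carrier A. f b \<noteq> \<zero>\<^bsub>A\<^esub>} \<union> {b \<in> carrier A. g b \<noteq> \<zero>\<^bsub>A\<^esub>}"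
    \<comment> \<open>The support of a sum may be smaller than the union of the supports; all three sums are
      compared on the union.\<close>
    have S: "finite ?S" "?S \<subseteq> carrier A" using fg by (auto simp: free_module_def)
    have FG: "f \<in> carrier A \<rightarrow> carrier A" "g \<in> carrier A \<rightarrow> carrier A"
      using fg by (auto simp: free_module_def)
    have fgb: "(f \<oplus>\<^bsub>F\<^esub> g) b = f b \<oplus>\<^bsub>A\<^esub> g b" if "b \<in> carrier A" for b
      using that by (simp add: free_module_def)
    have "\<Phi> (f \<oplus>\<^bsub>F\<^esub> g) = (\<Oplus>\<^bsub>M\<^esub>b\<in>?S. h ((f \<oplus>\<^bsub>F\<^esub> g) b) b)"
      using fg S by (intro \<Phi>_superset) (auto simp: fgb)
    also have "\<dots> = (\<Oplus>\<^bsub>M\<^esub>b\<in>?S. h (f b) b \<oplus>\<^bsub>M\<^esub> h (g b) b)"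
    proof (rule M.finsum_cong')
      fix b assume "b \<in> ?S"
      then have "b \<in> carrier A" by blast
      then show "h ((f \<oplus>\<^bsub>F\<^esub> g) b) b = h (f b) b \<oplus>\<^bsub>M\<^esub> h (g b) b"
        using FG by (simp add: fgb h_add Pi_def)
    qed (use S FG in \<open>simp_all add: Pi_def subset_iff\<close>)
    also have "\<dots> = (\<Oplus>\<^bsub>M\<^esub>b\<in>?S. h (f b) b) \<oplus>\<^bsub>M\<^esub> (\<Oplus>\<^bsub>M\<^esub>b\<in>?S. h (g b) b)"
      using S FG by (intro M.finsum_addf) (simp_all add: Pi_def subset_iff)
    also have "\<dots> = \<Phi> f \<oplus>\<^bsub>M\<^esub> \<Phi> g"
      using \<Phi>_superset[OF fg(1) S(1) _ S(2)] \<Phi>_superset[OF fg(2) S(1) _ S(2)] by simp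
    finally show ?thesis .
  qed
  ultimately show "group_hom (add_monoid F) (add_monoid M) \<Phi>"
    by (intro group_hom.intro group_hom_axioms.intro F.a_group M.a_group) (simp add: hom_def)
qed

lemma \<Phi>_gen:
  assumes "a \<in> carrier A" "b \<in> carrier A"
  shows "\<Phi> (a \<odot>\<^bsub>F\<^esub> free_gen A b) = h a b"
proof -
  have eq: "(a \<odot>\<^bsub>F\<^esub> free_gen A b) x = (if x = b then a else \<zero>\<^bsub>A\<^esub>)" if "x \<in> carrier A" for x
    using assms that by (simp add: free_module_def free_gen_def)
  have "\<Phi> (a \<odot>\<^bsub>F\<^esub> free_gen A b) = (\<Oplus>\<^bsub>M\<^esub>x\<in>{b}. h ((a \<odot>\<^bsub>F\<^esub> free_gen A b) x) x)"
    using assms by (intro \<Phi>_superset) (auto simp: eq split: if_splits)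
  then show ?thesis using assms by (simp add: eq)
qed

end


section \<open>Kaehler differentials\<close>

locale k_algebra = cring A
  for k :: "('k, 'c) ring_scheme" and A :: "('k, 'a, 'd) module_scheme" (structure) +
  assumes is_algebra: "algebra k A"
begin

lemma scalar_closed [simp]: "c \<in> carrier k \<Longrightarrow> a \<in> carrier A \<Longrightarrow> c \<odot> a \<in> carrier A"
  by (rule module.smult_closed[OF algebra.axioms(1)[OF is_algebra]])

lemma scalar_eq_mult: "c \<in> carrier k \<Longrightarrow> a \<in> carrier A \<Longrightarrow> c \<odot> a = (c \<odot> \<one>) \<otimes> a"
  using algebra.smult_assoc2[OF is_algebra] by simp

text \<open>
  With \<open>scalar_eq_mult\<close>, this moves scalars of $k$ into the coefficient, the form in which they occur
  in the relations of $\Omega^1$.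
\<close>

lemma scalar_assoc: "c \<in> carrier k \<Longrightarrow> a \<in> carrier A \<Longrightarrow> b \<in> carrier A \<Longrightarrow> a \<otimes> (c \<odot> b) = (a \<otimes> (c \<odot> \<one>)) \<otimes> b"
  by (subst scalar_eq_mult) (auto simp: m_assoc)

abbreviation d where "d \<equiv> univ_d k A"
abbreviation \<Omega> where "\<Omega> \<equiv> Kaehler k A"

sublocale F: module A "free_module A" by (rule free_module_is_module)

lemma relations_subset: "kaehler_relations k A \<subseteq> carrier F"
  by (auto simp: kaehler_relations_def Let_def)

sublocale K: quotient_by_submodule A F "kaehler_null k A"
  unfolding kaehler_null_def
  by (rule quotient_by_submodule.intro[OF F.module_axioms])
    (rule F.submodule_generated_is_submodule[OF relations_subset])

sublocale \<Omega>: module A \<Omega>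
  unfolding Kaehler_def by (rule K.quotient_is_module)

lemma d_closed [simp]: "a \<in> carrier A \<Longrightarrow> d a \<in> carrier \<Omega>"
  by (simp add: univ_d_def Kaehler_def K.carrier_quotient)

lemma smult_d: "a \<in> carrier A \<Longrightarrow> b \<in> carrier A \<Longrightarrow>
    a \<odot>\<^bsub>\<Omega>\<^esub> d b = kaehler_null k A +>\<^bsub>F\<^esub> (a \<odot>\<^bsub>F\<^esub> free_gen A b)"
  by (simp add: univ_d_def Kaehler_def K.smult_quotient)

lemma relation_in_null: "r \<in> kaehler_relations k A \<Longrightarrow> r \<in> kaehler_null k A"
  by (auto simp: kaehler_null_def submodule_generated_def)

lemma d_add:
  assumes "a \<in> carrier A" "b \<in> carrier A"
  shows "d (a \<oplus> b) = d a \<oplus>\<^bsub>\<Omega>\<^esub> d b"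
proof -
  have "free_gen A (a \<oplus> b) \<ominus>\<^bsub>F\<^esub> (free_gen A a \<oplus>\<^bsub>F\<^esub> free_gen A b) \<in> kaehler_null k A"
    using assms by (intro relation_in_null) (unfold kaehler_relations_def Let_def, blast)
  then show ?thesis using assms
    by (simp add: univ_d_def Kaehler_def K.add_quotient K.coset_eq_iff)
qed

lemma d_scalar:
  assumes "c \<in> carrier k" "a \<in> carrier A"
  shows "d (c \<odot> a) = (c \<odot> \<one>) \<odot>\<^bsub>\<Omega>\<^esub> d a"
proof -
  have "free_gen A (c \<odot> a) \<ominus>\<^bsub>F\<^esub> (c \<odot> \<one>) \<odot>\<^bsub>F\<^esub> free_gen A a \<in> kaehler_null k A"
    using assms by (intro relation_in_null) (unfold kaehler_relations_def Let_def, blast)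
  then show ?thesis using assms
    by (simp add: univ_d_def Kaehler_def K.smult_quotient K.coset_eq_iff)
qed

lemma d_mult:
  assumes "a \<in> carrier A" "b \<in> carrier A"
  shows "d (a \<otimes> b) = b \<odot>\<^bsub>\<Omega>\<^esub> d a \<oplus>\<^bsub>\<Omega>\<^esub> a \<odot>\<^bsub>\<Omega>\<^esub> d b"
proof -
  have "free_gen A (a \<otimes> b) \<ominus>\<^bsub>F\<^esub> (b \<odot>\<^bsub>F\<^esub> free_gen A a \<oplus>\<^bsub>F\<^esub> a \<odot>\<^bsub>F\<^esub> free_gen A b) \<in> kaehler_null k A"
    using assms by (intro relation_in_null) (unfold kaehler_relations_def Let_def, blast)
  then show ?thesis using assms
    by (simp add: univ_d_def Kaehler_def K.add_quotient K.smult_quotient K.coset_eq_iff)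
qed

text \<open>
  Identities between additive functions of $\alpha$ need to be checked only for $\alpha = a\,db$.
\<close>

lemma kaehler_induct [consumes 1, case_names generator add]:
  assumes \<alpha>: "\<alpha> \<in> carrier \<Omega>"
    and gen: "\<And>a b. a \<in> carrier A \<Longrightarrow> b \<in> carrier A \<Longrightarrow> P (a \<odot>\<^bsub>\<Omega>\<^esub> d b)"
    and add: "\<And>\<alpha> \<beta>. \<alpha> \<in> carrier \<Omega> \<Longrightarrow> \<beta> \<in> carrier \<Omega> \<Longrightarrow> P \<alpha> \<Longrightarrow> P \<beta> \<Longrightarrow> P (\<alpha> \<oplus>\<^bsub>\<Omega>\<^esub> \<beta>)"
  shows "P \<alpha>"
proof -
  obtain f where f: "f \<in> carrier F" and \<alpha>_eq: "\<alpha> = kaehler_null k A +>\<^bsub>F\<^esub> f"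
    using \<alpha> by (auto simp: Kaehler_def K.carrier_quotient)
  from f have "P (kaehler_null k A +>\<^bsub>F\<^esub> f)"
  proof (rule free_module_induct)
    fix a b assume "a \<in> carrier A" "b \<in> carrier A"
    then show "P (kaehler_null k A +>\<^bsub>F\<^esub> a \<odot>\<^bsub>F\<^esub> free_gen A b)"
      using gen[of a b] by (simp add: smult_d)
  next
    fix f g
    assume "f \<in> carrier F" "g \<in> carrier F"
      "P (kaehler_null k A +>\<^bsub>F\<^esub> f)" "P (kaehler_null k A +>\<^bsub>F\<^esub> g)"
    then show "P (kaehler_null k A +>\<^bsub>F\<^esub> (f \<oplus>\<^bsub>F\<^esub> g))"
      using add[of "kaehler_null k A +>\<^bsub>F\<^esub> f" "kaehler_null k A +>\<^bsub>F\<^esub> g"]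
      by (simp add: Kaehler_def K.carrier_quotient K.add_quotient)
  qed
  then show ?thesis by (simp only: \<alpha>_eq)
qed

text \<open>
  The hypotheses say that $h$ respects the three families of relations, each multiplied by an arbitrary
  coefficient $a$. The null submodule is the additive span of these multiples, so an additive map that
  respects them descends to $\Omega^1$.
\<close>

lemma kaehler_lift:
  fixes M :: "('m, 'e) ring_scheme"
  assumes M: "abelian_group M"
    and closed: "\<And>a b. a \<in> carrier A \<Longrightarrow> b \<in> carrier A \<Longrightarrow> h a b \<in> carrier M"
    and add_l: "\<And>a a' b. a \<in> carrier A \<Longrightarrow> a' \<in> carrier A \<Longrightarrow> b \<in> carrier A \<Longrightarrow>
      h (a \<oplus> a') b = h a b \<oplus>\<^bsub>M\<^esub> h a' b"
    and add_r: "\<And>a b b'. a \<in> carrier A \<Longrightarrow> b \<in> carrier A \<Longrightarrow> b' \<in> carrier A \<Longrightarrow>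
      h a (b \<oplus> b') = h a b \<oplus>\<^bsub>M\<^esub> h a b'"
    and h_scalar: "\<And>a c b. a \<in> carrier A \<Longrightarrow> c \<in> carrier k \<Longrightarrow> b \<in> carrier A \<Longrightarrow>
      h a (c \<odot> b) = h (a \<otimes> (c \<odot> \<one>)) b"
    and h_mult: "\<And>a b b'. a \<in> carrier A \<Longrightarrow> b \<in> carrier A \<Longrightarrow> b' \<in> carrier A \<Longrightarrow>
      h a (b \<otimes> b') = h (a \<otimes> b') b \<oplus>\<^bsub>M\<^esub> h (a \<otimes> b) b'"
  shows "abelian_group_hom \<Omega> M (kaehler_lift A M h)"
    and "a \<in> carrier A \<Longrightarrow> b \<in> carrier A \<Longrightarrow> kaehler_lift A M h (a \<odot>\<^bsub>\<Omega>\<^esub> d b) = h a b"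
proof -
  interpret M: abelian_group M by (rule M)
  interpret V: free_evaluation A M h
    by unfold_locales (simp_all add: closed add_l)
  have rel: "V.\<Phi> (c \<odot>\<^bsub>F\<^esub> r) = \<zero>\<^bsub>M\<^esub>" if "c \<in> carrier A" "r \<in> kaehler_relations k A" for c r
  proof -
    note expand = F.smult_r_diff F.smult_r_distr F.smult_assoc1[symmetric]
      V.\<Phi>.hom_diff V.\<Phi>_gen M.diff_eq_zero_iff
    from that(2) consider
      (add) a b where "a \<in> carrier A" "b \<in> carrier A"
        "r = free_gen A (a \<oplus> b) \<ominus>\<^bsub>F\<^esub> (free_gen A a \<oplus>\<^bsub>F\<^esub> free_gen A b)"
      | (scalar) x a where "x \<in> carrier k" "a \<in> carrier A"
        "r = free_gen A (x \<odot> a) \<ominus>\<^bsub>F\<^esub> (x \<odot> \<one>) \<odot>\<^bsub>F\<^esub> free_gen A a"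
      | (mult) a b where "a \<in> carrier A" "b \<in> carrier A"
        "r = free_gen A (a \<otimes> b) \<ominus>\<^bsub>F\<^esub> (b \<odot>\<^bsub>F\<^esub> free_gen A a \<oplus>\<^bsub>F\<^esub> a \<odot>\<^bsub>F\<^esub> free_gen A b)"
      unfolding kaehler_relations_def Let_def by blast
    then show ?thesis
    proof cases
      case add
      then show ?thesis using that(1) by (simp add: expand add_r closed)
    next
      case scalar
      then show ?thesis using that(1)
        by (simp add: expand closed h_scalar)
    next
      case mult
      then show ?thesis using that(1)
        by (simp add: expand closed h_mult)
    qed
  qed
  have null: "V.\<Phi> n = \<zero>\<^bsub>M\<^esub>" if "n \<in> kaehler_null k A" for n
    by (rule F.additive_vanishes_on_generated[OF V.\<Phi>.abelian_group_hom_axioms relations_subset _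
          that[unfolded kaehler_null_def]]) (rule rel)
  \<comment> \<open>Representatives of a class differ by a null element, so the image under evaluation is a singleton.\<close>
  have lift: "kaehler_lift A M h (kaehler_null k A +>\<^bsub>F\<^esub> f) = V.\<Phi> f" if f: "f \<in> carrier F" for f
  proof -
    have "V.\<Phi> g = V.\<Phi> f" if "g \<in> kaehler_null k A +>\<^bsub>F\<^esub> f" for g
    proof -
      have g: "g \<in> carrier F" "g \<ominus>\<^bsub>F\<^esub> f \<in> kaehler_null k A"
        using that K.coset_mem[OF f] by blast+
      then have "V.\<Phi> g \<ominus>\<^bsub>M\<^esub> V.\<Phi> f = \<zero>\<^bsub>M\<^esub>" using null[OF g(2)] f by (simp add: V.\<Phi>.hom_diff)
      then show ?thesis using g f by (simp add: M.diff_eq_zero_iff)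
    qed
    moreover have "f \<in> kaehler_null k A +>\<^bsub>F\<^esub> f" using f by (rule K.N.a_rcos_self)
    ultimately have "V.\<Phi> ` (kaehler_null k A +>\<^bsub>F\<^esub> f) = {V.\<Phi> f}" by blast
    then show ?thesis by (simp add: kaehler_lift_def V.\<Phi>_def[abs_def])
  qed
  show "a \<in> carrier A \<Longrightarrow> b \<in> carrier A \<Longrightarrow> kaehler_lift A M h (a \<odot>\<^bsub>\<Omega>\<^esub> d b) = h a b"
    by (simp add: smult_d lift V.\<Phi>_gen)
  have "kaehler_lift A M h \<in> hom (add_monoid \<Omega>) (add_monoid M)"
    unfolding hom_def by (clarsimp simp: Kaehler_def K.carrier_quotient K.add_quotient lift)
  then show "abelian_group_hom \<Omega> M (kaehler_lift A M h)"
    by (intro abelian_group_homI group_hom.intro group_hom_axioms.intro \<Omega>.a_group M.a_group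
        \<Omega>.abelian_group_axioms M)
qed

end


section \<open>Derivations\<close>

context k_algebra
begin

abbreviation D where "D \<equiv> Der k A"

lemma derivation_closed: "X \<in> carrier D \<Longrightarrow> a \<in> carrier A \<Longrightarrow> X a \<in> carrier A"
  by (auto simp: Der_def derivations_def)

lemma derivation_add: "X \<in> carrier D \<Longrightarrow> a \<in> carrier A \<Longrightarrow> b \<in> carrier A \<Longrightarrow>
    X (a \<oplus> b) = X a \<oplus> X b"
  by (simp add: Der_def derivations_def)

lemma derivation_scalar: "X \<in> carrier D \<Longrightarrow> c \<in> carrier k \<Longrightarrow> a \<in> carrier A \<Longrightarrow>
    X (c \<odot> a) = c \<odot> X a"
  by (simp add: Der_def derivations_def)

lemma derivation_mult: "X \<in> carrier D \<Longrightarrow> a \<in> carrier A \<Longrightarrow> b \<in> carrier A \<Longrightarrow>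
    X (a \<otimes> b) = X a \<otimes> b \<oplus> a \<otimes> X b"
  by (simp add: Der_def derivations_def)

lemmas derivation_simps = derivation_closed derivation_add derivation_scalar derivation_mult

lemma derivation_additive:
  assumes "X \<in> carrier D"
  shows "abelian_group_hom A A X"
  by (intro abelian_group_homI group_hom.intro group_hom_axioms.intro a_group abelian_group_axioms)
    (use assms in \<open>simp add: hom_def Pi_def derivation_closed derivation_add\<close>)

lemma derivation_zero: "X \<in> carrier D \<Longrightarrow> X \<zero> = \<zero>"
  using abelian_group_hom.hom_zero[OF derivation_additive] .

lemma derivation_one: "X \<in> carrier D \<Longrightarrow> X \<one> = \<zero>"
  using derivation_mult[of X \<one> \<one>] add.l_cancel_one[of "X \<one>" "X \<one>"] by (simp add: derivation_closed)

lemma derivation_eqI: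
  assumes "X \<in> carrier D" "Y \<in> carrier D" "\<And>a. a \<in> carrier A \<Longrightarrow> X a = Y a"
  shows "X = Y"
  using assms by (auto simp: Der_def derivations_def intro: PiE_ext)

lemma derivationI:
  assumes "\<And>a. a \<in> carrier A \<Longrightarrow> X a \<in> carrier A"
    and "\<And>a b. a \<in> carrier A \<Longrightarrow> b \<in> carrier A \<Longrightarrow> X (a \<oplus> b) = X a \<oplus> X b"
    and "\<And>c a. c \<in> carrier k \<Longrightarrow> a \<in> carrier A \<Longrightarrow> X (c \<odot> a) = c \<odot> X a"
    and "\<And>a b. a \<in> carrier A \<Longrightarrow> b \<in> carrier A \<Longrightarrow> X (a \<otimes> b) = X a \<otimes> b \<oplus> a \<otimes> X b"
  shows "(\<lambda>b\<in>carrier A. X b) \<in> carrier D"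
  using assms by (simp add: Der_def derivations_def)

lemma scalar_add: "c \<in> carrier k \<Longrightarrow> a \<in> carrier A \<Longrightarrow> b \<in> carrier A \<Longrightarrow>
    c \<odot> (a \<oplus> b) = c \<odot> a \<oplus> c \<odot> b"
  by (rule module.smult_r_distr[OF algebra.axioms(1)[OF is_algebra]])

lemma mult_scalar: "c \<in> carrier k \<Longrightarrow> a \<in> carrier A \<Longrightarrow> b \<in> carrier A \<Longrightarrow>
    a \<otimes> (c \<odot> b) = c \<odot> (a \<otimes> b)"
  using algebra.smult_assoc2[OF is_algebra, of c b a] by (simp add: m_comm)

sublocale D: module A D
proof -
  interpret G: module A "function_module A" by (rule function_module)
  have "submodule (derivations k A) A (function_module A)"
  proof (rule G.submodule_criterion)
    show "derivations k A \<subseteq> carrier (function_module A)"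
      by (auto simp: derivations_def function_module_def)
    show "\<zero>\<^bsub>function_module A\<^esub> \<in> derivations k A"
      using derivationI[of "\<lambda>_. \<zero>"] scalar_eq_mult[of _ \<zero>]
      by (simp add: function_module_def Der_def)
  next
    fix X Y assume "X \<in> derivations k A" "Y \<in> derivations k A"
    then have XY: "X \<in> carrier D" "Y \<in> carrier D" by (simp_all add: Der_def)
    have "(\<lambda>b\<in>carrier A. X b \<oplus> Y b) \<in> carrier D"
      by (rule derivationI)
        (simp_all add: derivation_simps[OF XY(1)] derivation_simps[OF XY(2)] scalar_add l_distr r_distr a_ac)
    then show "X \<oplus>\<^bsub>function_module A\<^esub> Y \<in> derivations k A"
      by (simp add: function_module_def Der_def)
  next
    fix a X assume a: "a \<in> carrier A" and "X \<in> derivations k A"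
    then have X: "X \<in> carrier D" by (simp add: Der_def)
    have "(\<lambda>b\<in>carrier A. a \<otimes> X b) \<in> carrier D"
      by (rule derivationI)
        (simp_all add: derivation_simps[OF X] a mult_scalar r_distr m_ac)
    then show "a \<odot>\<^bsub>function_module A\<^esub> X \<in> derivations k A"
      by (simp add: function_module_def Der_def)
  qed
  then have "module A (function_module A\<lparr>carrier := derivations k A\<rparr>)"
    by (rule submodule.submodule_is_module) (rule function_module)
  then show "module A D" by (simp add: Der_def function_module_def)
qed

lemma D_add_apply: "b \<in> carrier A \<Longrightarrow> (X \<oplus>\<^bsub>D\<^esub> Y) b = X b \<oplus> Y b"
  and D_smult_apply: "b \<in> carrier A \<Longrightarrow> (a \<odot>\<^bsub>D\<^esub> X) b = a \<otimes> X b"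
  and D_zero_apply: "b \<in> carrier A \<Longrightarrow> \<zero>\<^bsub>D\<^esub> b = \<zero>"
  by (simp_all add: Der_def)

lemma commutator_apply: "b \<in> carrier A \<Longrightarrow> commutator A X Y b = X (Y b) \<ominus> Y (X b)"
  by (simp add: commutator_def)

lemma scalar_diff: "c \<in> carrier k \<Longrightarrow> a \<in> carrier A \<Longrightarrow> b \<in> carrier A \<Longrightarrow>
    c \<odot> (a \<ominus> b) = c \<odot> a \<ominus> c \<odot> b"
  by (rule module.smult_r_diff[OF algebra.axioms(1)[OF is_algebra]])

lemma commutator_closed:
  assumes X: "X \<in> carrier D" and Y: "Y \<in> carrier D"
  shows "commutator A X Y \<in> carrier D"
  unfolding commutator_def
proof (rule derivationI)
  note [simp] = derivation_simps[OF X] derivation_simps[OF Y]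
  fix a b assume ab: "a \<in> carrier A" "b \<in> carrier A"
  show "X (Y a) \<ominus> Y (X a) \<in> carrier A" using ab by simp
  show "X (Y (a \<oplus> b)) \<ominus> Y (X (a \<oplus> b)) = X (Y a) \<ominus> Y (X a) \<oplus> (X (Y b) \<ominus> Y (X b))"
    using ab by (simp add: a_minus_def minus_add a_ac)
  have "X (Y (a \<otimes> b)) \<ominus> Y (X (a \<otimes> b)) =
    (X (Y a) \<otimes> b \<oplus> Y a \<otimes> X b \<oplus> (X a \<otimes> Y b \<oplus> a \<otimes> X (Y b))) \<ominus>
    (Y (X a) \<otimes> b \<oplus> X a \<otimes> Y b \<oplus> (Y a \<otimes> X b \<oplus> a \<otimes> Y (X b)))"
    using ab by simp
  also have "\<dots> = (X (Y a) \<ominus> Y (X a)) \<otimes> b \<oplus> a \<otimes> (X (Y b) \<ominus> Y (X b))"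
  proof -
    have "X a \<in> carrier A" "X b \<in> carrier A" "Y a \<in> carrier A" "Y b \<in> carrier A"
      "X (Y a) \<in> carrier A" "X (Y b) \<in> carrier A" "Y (X a) \<in> carrier A" "Y (X b) \<in> carrier A"
      using ab by simp_all
    with ab show ?thesis by algebra
  qed
  finally show "X (Y (a \<otimes> b)) \<ominus> Y (X (a \<otimes> b)) =
    (X (Y a) \<ominus> Y (X a)) \<otimes> b \<oplus> a \<otimes> (X (Y b) \<ominus> Y (X b))" .
next
  note [simp] = derivation_simps[OF X] derivation_simps[OF Y]
  fix c a assume "c \<in> carrier k" "a \<in> carrier A"
  then show "X (Y (c \<odot> a)) \<ominus> Y (X (c \<odot> a)) = c \<odot> (X (Y a) \<ominus> Y (X a))"
    by (simp add: scalar_diff)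
qed


section \<open>The pairing and the Lie derivative\<close>

abbreviation pair where "pair \<equiv> pairing A"
abbreviation Lie where "Lie \<equiv> lie_derivative k A"

lemma pair_additive: "X \<in> carrier D \<Longrightarrow> abelian_group_hom \<Omega> A (pair X)"
  and pair_generator: "X \<in> carrier D \<Longrightarrow> a \<in> carrier A \<Longrightarrow> b \<in> carrier A \<Longrightarrow>
    pair X (a \<odot>\<^bsub>\<Omega>\<^esub> d b) = a \<otimes> X b"
  unfolding pairing_def
   by (rule kaehler_lift[OF abelian_group_axioms];
      simp add: derivation_simps mult_scalar scalar_assoc[symmetric] l_distr r_distr m_ac a_ac)+

lemma pair_closed [simp]: "X \<in> carrier D \<Longrightarrow> \<alpha> \<in> carrier \<Omega> \<Longrightarrow> pair X \<alpha> \<in> carrier A"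
  using abelian_group_hom.hom_closed[OF pair_additive] .

lemma pair_add: "X \<in> carrier D \<Longrightarrow> \<alpha> \<in> carrier \<Omega> \<Longrightarrow> \<beta> \<in> carrier \<Omega> \<Longrightarrow>
    pair X (\<alpha> \<oplus>\<^bsub>\<Omega>\<^esub> \<beta>) = pair X \<alpha> \<oplus> pair X \<beta>"
  using abelian_group_hom.hom_add[OF pair_additive] .

lemma pair_d: "X \<in> carrier D \<Longrightarrow> b \<in> carrier A \<Longrightarrow> pair X (d b) = X b"
  using pair_generator[of X \<one> b] by (simp add: derivation_closed)

lemma pair_smult:
  assumes X: "X \<in> carrier D" and c: "c \<in> carrier A" and \<alpha>: "\<alpha> \<in> carrier \<Omega>"
  shows "pair X (c \<odot>\<^bsub>\<Omega>\<^esub> \<alpha>) = c \<otimes> pair X \<alpha>"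
  using \<alpha>
proof (induction rule: kaehler_induct)
  case (generator a b)
  then show ?case using X c
    by (simp add: \<Omega>.smult_assoc1[symmetric] pair_generator derivation_closed m_assoc)
next
  case (add \<alpha> \<beta>)
  then show ?case using X c by (simp add: \<Omega>.smult_r_distr pair_add r_distr)
qed

lemma pair_D_add:
  assumes X: "X \<in> carrier D" and Y: "Y \<in> carrier D" and \<alpha>: "\<alpha> \<in> carrier \<Omega>"
  shows "pair (X \<oplus>\<^bsub>D\<^esub> Y) \<alpha> = pair X \<alpha> \<oplus> pair Y \<alpha>"
  using \<alpha>
proof (induction rule: kaehler_induct)
  case (generator a b)
  then show ?case using X Y
    by (simp add: pair_generator D_add_apply derivation_closed r_distr)
next
  case (add \<alpha> \<beta>)
  then show ?case using X Y by (simp add: pair_add a_ac)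
qed

lemma pair_D_smult:
  assumes c: "c \<in> carrier A" and X: "X \<in> carrier D" and \<alpha>: "\<alpha> \<in> carrier \<Omega>"
  shows "pair (c \<odot>\<^bsub>D\<^esub> X) \<alpha> = c \<otimes> pair X \<alpha>"
  using \<alpha>
proof (induction rule: kaehler_induct)
  case (generator a b)
  then show ?case using X c
    by (simp add: pair_generator D_smult_apply derivation_closed m_lcomm)
next
  case (add \<alpha> \<beta>)
  then show ?case using X c by (simp add: pair_add r_distr)
qed

lemma Lie_lift:
  assumes X: "X \<in> carrier D"
  shows "abelian_group_hom \<Omega> \<Omega> (Lie X)"
    and "a \<in> carrier A \<Longrightarrow> b \<in> carrier A \<Longrightarrow>
      Lie X (a \<odot>\<^bsub>\<Omega>\<^esub> d b) = X a \<odot>\<^bsub>\<Omega>\<^esub> d b \<oplus>\<^bsub>\<Omega>\<^esub> a \<odot>\<^bsub>\<Omega>\<^esub> d (X b)"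
proof -
  note [simp] = derivation_simps[OF X]
  let ?h = "\<lambda>a b. X a \<odot>\<^bsub>\<Omega>\<^esub> d b \<oplus>\<^bsub>\<Omega>\<^esub> a \<odot>\<^bsub>\<Omega>\<^esub> d (X b)"
  have scalar: "?h a (c \<odot> b) = ?h (a \<otimes> (c \<odot> \<one>)) b"
    if "a \<in> carrier A" "c \<in> carrier k" "b \<in> carrier A" for a c b
    using that by (simp add: d_scalar mult_scalar \<Omega>.smult_assoc1[symmetric] derivation_one[OF X]) 
  have mult: "?h a (b \<otimes> b') = ?h (a \<otimes> b') b \<oplus>\<^bsub>\<Omega>\<^esub> ?h (a \<otimes> b) b'"
    if "a \<in> carrier A" "b \<in> carrier A" "b' \<in> carrier A" for a b b'
    using that
    by (simp add: d_add d_mult \<Omega>.smult_l_distr \<Omega>.smult_r_distr \<Omega>.smult_assoc1[symmetric]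
        \<Omega>.add.m_ac)
  note lift = kaehler_lift[of \<Omega> ?h, OF \<Omega>.abelian_group_axioms _ _ _ scalar mult]
  show "abelian_group_hom \<Omega> \<Omega> (Lie X)"
    unfolding lie_derivative_def
    by (rule lift(1))
      (simp_all add: d_add \<Omega>.smult_l_distr \<Omega>.smult_r_distr \<Omega>.add.m_ac)
  show "a \<in> carrier A \<Longrightarrow> b \<in> carrier A \<Longrightarrow>
      Lie X (a \<odot>\<^bsub>\<Omega>\<^esub> d b) = X a \<odot>\<^bsub>\<Omega>\<^esub> d b \<oplus>\<^bsub>\<Omega>\<^esub> a \<odot>\<^bsub>\<Omega>\<^esub> d (X b)"
    unfolding lie_derivative_def
    by (rule lift(2))
      (simp_all add: d_add \<Omega>.smult_l_distr \<Omega>.smult_r_distr \<Omega>.add.m_ac)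
qed

lemmas Lie_generator = Lie_lift(2)

lemma Lie_closed [simp]: "X \<in> carrier D \<Longrightarrow> \<alpha> \<in> carrier \<Omega> \<Longrightarrow> Lie X \<alpha> \<in> carrier \<Omega>"
  using abelian_group_hom.hom_closed[OF Lie_lift(1)] .

lemma Lie_add: "X \<in> carrier D \<Longrightarrow> \<alpha> \<in> carrier \<Omega> \<Longrightarrow> \<beta> \<in> carrier \<Omega> \<Longrightarrow>
    Lie X (\<alpha> \<oplus>\<^bsub>\<Omega>\<^esub> \<beta>) = Lie X \<alpha> \<oplus>\<^bsub>\<Omega>\<^esub> Lie X \<beta>"
  using abelian_group_hom.hom_add[OF Lie_lift(1)] .

lemma Lie_d: "X \<in> carrier D \<Longrightarrow> b \<in> carrier A \<Longrightarrow> Lie X (d b) = d (X b)"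
  using Lie_generator[of X \<one> b] by (simp add: derivation_closed derivation_one)

lemma Lie_smult:
  assumes X: "X \<in> carrier D" and c: "c \<in> carrier A" and \<alpha>: "\<alpha> \<in> carrier \<Omega>"
  shows "Lie X (c \<odot>\<^bsub>\<Omega>\<^esub> \<alpha>) = X c \<odot>\<^bsub>\<Omega>\<^esub> \<alpha> \<oplus>\<^bsub>\<Omega>\<^esub> c \<odot>\<^bsub>\<Omega>\<^esub> Lie X \<alpha>"
  using \<alpha>
proof (induction rule: kaehler_induct)
  case (generator a b)
  then show ?case using X c
    by (simp add: \<Omega>.smult_assoc1[symmetric] Lie_generator derivation_simps
        \<Omega>.smult_l_distr \<Omega>.smult_r_distr \<Omega>.add.m_ac)
next
  case (add \<alpha> \<beta>)
  then show ?case using X c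
    by (simp add: \<Omega>.smult_r_distr Lie_add derivation_closed \<Omega>.add.m_ac)
qed

lemma Lie_D_add:
  assumes X: "X \<in> carrier D" and Y: "Y \<in> carrier D" and \<alpha>: "\<alpha> \<in> carrier \<Omega>"
  shows "Lie (X \<oplus>\<^bsub>D\<^esub> Y) \<alpha> = Lie X \<alpha> \<oplus>\<^bsub>\<Omega>\<^esub> Lie Y \<alpha>"
  using \<alpha>
proof (induction rule: kaehler_induct)
  case (generator a b)
  then show ?case using X Y
    by (simp add: Lie_generator D_add_apply derivation_closed d_add
        \<Omega>.smult_l_distr \<Omega>.smult_r_distr \<Omega>.add.m_ac)
next
  case (add \<alpha> \<beta>)
  then show ?case using X Y by (simp add: Lie_add \<Omega>.add.m_ac)
qed

text \<open>
  The Lie derivative is not tensorial in the vector field; the defect $\langle X,\alpha\rangle\,dc$ is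
  one of the two contributions to the anomalous term in the Leibniz rule of the Courant bracket.
\<close>

lemma Lie_D_smult:
  assumes c: "c \<in> carrier A" and X: "X \<in> carrier D" and \<alpha>: "\<alpha> \<in> carrier \<Omega>"
  shows "Lie (c \<odot>\<^bsub>D\<^esub> X) \<alpha> = c \<odot>\<^bsub>\<Omega>\<^esub> Lie X \<alpha> \<oplus>\<^bsub>\<Omega>\<^esub> pair X \<alpha> \<odot>\<^bsub>\<Omega>\<^esub> d c"
  using \<alpha>
proof (induction rule: kaehler_induct)
  case (generator a b)
  then show ?case using X c
    by (simp add: Lie_generator pair_generator D_smult_apply derivation_closed d_mult
        \<Omega>.smult_r_distr \<Omega>.smult_assoc1[symmetric] m_comm \<Omega>.add.m_ac)
next
  case (add \<alpha> \<beta>)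
  then show ?case using X c
    by (simp add: Lie_add pair_add \<Omega>.smult_l_distr \<Omega>.smult_r_distr \<Omega>.add.m_ac)
qed

text \<open>
  Cartan's relation $[\mathcal{L}_Y, \iota_X] = \iota_{[Y,X]}$ on one-forms.
\<close>

lemma pair_Lie:
  assumes X: "X \<in> carrier D" and Y: "Y \<in> carrier D" and \<beta>: "\<beta> \<in> carrier \<Omega>"
  shows "pair X (Lie Y \<beta>) = Y (pair X \<beta>) \<ominus> pair (commutator A Y X) \<beta>"
  using \<beta>
proof (induction rule: kaehler_induct)
  case (generator a b)
  have "Y a \<in> carrier A" "X b \<in> carrier A" "Y (X b) \<in> carrier A" "X (Y b) \<in> carrier A"
    using X Y generator by (simp_all add: derivation_closed)
  then have "Y a \<otimes> X b \<oplus> a \<otimes> X (Y b) =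
      (Y a \<otimes> X b \<oplus> a \<otimes> Y (X b)) \<ominus> a \<otimes> (Y (X b) \<ominus> X (Y b))"
    using generator by algebra
  then show ?case using X Y generator
    by (simp add: Lie_generator pair_generator pair_add commutator_closed commutator_apply
        derivation_simps)
next
  case (add \<alpha> \<beta>)
  then show ?case using X Y
    by (simp add: Lie_add pair_add commutator_closed derivation_simps a_minus_def minus_add a_ac)
qed

end


section \<open>The Courant bracket\<close>

context k_algebra
begin

abbreviation E where "E \<equiv> E_module k A"
abbreviation J where "J \<equiv> J_ideal k A"
abbreviation form where "form \<equiv> E_form A"
abbreviation bracket where "bracket \<equiv> E_bracket k A"

lemma d_zero: "d \<zero> = \<zero>\<^bsub>\<Omega>\<^esub>"
  using d_add[of \<zero> \<zero>] \<Omega>.add.l_cancel_one[of "d \<zero>" "d \<zero>"] by simp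

lemma pair_zero: "X \<in> carrier D \<Longrightarrow> pair X \<zero>\<^bsub>\<Omega>\<^esub> = \<zero>"
  using abelian_group_hom.hom_zero[OF pair_additive] .

lemma pair_minus: "X \<in> carrier D \<Longrightarrow> \<alpha> \<in> carrier \<Omega> \<Longrightarrow> pair X (\<ominus>\<^bsub>\<Omega>\<^esub> \<alpha>) = \<ominus> pair X \<alpha>"
  using abelian_group_hom.hom_a_inv[OF pair_additive] .

lemma pair_D_zero: "\<alpha> \<in> carrier \<Omega> \<Longrightarrow> pair \<zero>\<^bsub>D\<^esub> \<alpha> = \<zero>"
  using pair_D_smult[of \<zero> "\<zero>\<^bsub>D\<^esub>" \<alpha>] by simp

lemma Lie_D_zero: "\<alpha> \<in> carrier \<Omega> \<Longrightarrow> Lie \<zero>\<^bsub>D\<^esub> \<alpha> = \<zero>\<^bsub>\<Omega>\<^esub>"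
  using Lie_D_smult[of \<zero> "\<zero>\<^bsub>D\<^esub>" \<alpha>] by (simp add: d_zero)

lemma commutator_zero:
  assumes "X \<in> carrier D"
  shows "commutator A X \<zero>\<^bsub>D\<^esub> = \<zero>\<^bsub>D\<^esub>" and "commutator A \<zero>\<^bsub>D\<^esub> X = \<zero>\<^bsub>D\<^esub>"
  using assms
  by (auto intro!: derivation_eqI commutator_closed
      simp: commutator_apply D_zero_apply derivation_zero derivation_closed diff_eq_zero_iff)

lemma commutator_add:
  assumes X: "X \<in> carrier D" and Y: "Y \<in> carrier D" and Z: "Z \<in> carrier D"
  shows "commutator A (X \<oplus>\<^bsub>D\<^esub> Y) Z = commutator A X Z \<oplus>\<^bsub>D\<^esub> commutator A Y Z"
    and "commutator A Z (X \<oplus>\<^bsub>D\<^esub> Y) = commutator A Z X \<oplus>\<^bsub>D\<^esub> commutator A Z Y"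
proof -
  note [simp] = commutator_apply D_add_apply commutator_closed X Y Z derivation_closed derivation_add
  show "commutator A (X \<oplus>\<^bsub>D\<^esub> Y) Z = commutator A X Z \<oplus>\<^bsub>D\<^esub> commutator A Y Z"
    by (rule derivation_eqI) (simp_all add: a_minus_def minus_add a_ac)
  show "commutator A Z (X \<oplus>\<^bsub>D\<^esub> Y) = commutator A Z X \<oplus>\<^bsub>D\<^esub> commutator A Z Y"
    by (rule derivation_eqI) (simp_all add: a_minus_def minus_add a_ac)
qed

lemma commutator_smult:
  assumes f: "f \<in> carrier A" and X: "X \<in> carrier D" and Y: "Y \<in> carrier D"
  shows "commutator A (f \<odot>\<^bsub>D\<^esub> X) Y = f \<odot>\<^bsub>D\<^esub> commutator A X Y \<oplus>\<^bsub>D\<^esub> (\<ominus> Y f) \<odot>\<^bsub>D\<^esub> X"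
    and "commutator A X (f \<odot>\<^bsub>D\<^esub> Y) = f \<odot>\<^bsub>D\<^esub> commutator A X Y \<oplus>\<^bsub>D\<^esub> X f \<odot>\<^bsub>D\<^esub> Y"
proof -
  note [simp] = commutator_apply D_add_apply D_smult_apply commutator_closed f X Y
    derivation_closed derivation_mult
  have cl: "X b \<in> carrier A" "Y b \<in> carrier A" "X (Y b) \<in> carrier A" "Y (X b) \<in> carrier A"
    if "b \<in> carrier A" for b using that by simp_all
  show "commutator A (f \<odot>\<^bsub>D\<^esub> X) Y = f \<odot>\<^bsub>D\<^esub> commutator A X Y \<oplus>\<^bsub>D\<^esub> (\<ominus> Y f) \<odot>\<^bsub>D\<^esub> X"
  proof (rule derivation_eqI)
    fix b assume b: "b \<in> carrier A"
    have "f \<otimes> X (Y b) \<ominus> (Y f \<otimes> X b \<oplus> f \<otimes> Y (X b)) =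
        f \<otimes> (X (Y b) \<ominus> Y (X b)) \<oplus> (\<ominus> Y f) \<otimes> X b"
      using b f cl[OF b] cl[OF f] by algebra
    then show "commutator A (f \<odot>\<^bsub>D\<^esub> X) Y b =
        (f \<odot>\<^bsub>D\<^esub> commutator A X Y \<oplus>\<^bsub>D\<^esub> (\<ominus> Y f) \<odot>\<^bsub>D\<^esub> X) b"
      using b by simp
  qed simp_all
  show "commutator A X (f \<odot>\<^bsub>D\<^esub> Y) = f \<odot>\<^bsub>D\<^esub> commutator A X Y \<oplus>\<^bsub>D\<^esub> X f \<odot>\<^bsub>D\<^esub> Y"
  proof (rule derivation_eqI)
    fix b assume b: "b \<in> carrier A"
    have "(X f \<otimes> Y b \<oplus> f \<otimes> X (Y b)) \<ominus> f \<otimes> Y (X b) =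
        f \<otimes> (X (Y b) \<ominus> Y (X b)) \<oplus> X f \<otimes> Y b"
      using b f cl[OF b] cl[OF f] by algebra
    then show "commutator A X (f \<odot>\<^bsub>D\<^esub> Y) b =
        (f \<odot>\<^bsub>D\<^esub> commutator A X Y \<oplus>\<^bsub>D\<^esub> X f \<odot>\<^bsub>D\<^esub> Y) b"
      using b by simp
  qed simp_all
qed

sublocale E: module A E
  unfolding E_module_def by (rule direct_sum_module) (rule D.module_axioms \<Omega>.module_axioms)+

lemma E_carrier: "carrier E = carrier D \<times> carrier \<Omega>"
  and E_add: "(X, \<alpha>) \<oplus>\<^bsub>E\<^esub> (Y, \<beta>) = (X \<oplus>\<^bsub>D\<^esub> Y, \<alpha> \<oplus>\<^bsub>\<Omega>\<^esub> \<beta>)"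
  and E_smult: "a \<odot>\<^bsub>E\<^esub> (X, \<alpha>) = (a \<odot>\<^bsub>D\<^esub> X, a \<odot>\<^bsub>\<Omega>\<^esub> \<alpha>)"
  and E_zero: "\<zero>\<^bsub>E\<^esub> = (\<zero>\<^bsub>D\<^esub>, \<zero>\<^bsub>\<Omega>\<^esub>)"
  by (simp_all add: E_module_def direct_sum_def)

lemma form_pair: "form (X, \<alpha>) (Y, \<beta>) = pair Y \<alpha> \<oplus> pair X \<beta>"
  by (simp add: E_form_def)

lemma form_sym: "u \<in> carrier E \<Longrightarrow> v \<in> carrier E \<Longrightarrow> form u v = form v u"
  by (cases u; cases v) (simp add: E_carrier form_pair a_comm)

lemma form_closed: "u \<in> carrier E \<Longrightarrow> v \<in> carrier E \<Longrightarrow> form u v \<in> carrier A"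
  by (cases u; cases v) (simp add: E_carrier form_pair)

lemma form_add: "u \<in> carrier E \<Longrightarrow> v \<in> carrier E \<Longrightarrow> w \<in> carrier E \<Longrightarrow>
    form (u \<oplus>\<^bsub>E\<^esub> v) w = form u w \<oplus> form v w"
  by (cases u; cases v; cases w)
    (simp add: E_carrier E_add form_pair pair_add pair_D_add a_ac)

lemma form_smult: "a \<in> carrier A \<Longrightarrow> u \<in> carrier E \<Longrightarrow> v \<in> carrier E \<Longrightarrow>
    form (a \<odot>\<^bsub>E\<^esub> u) v = a \<otimes> form u v"
  by (cases u; cases v) (simp add: E_carrier E_smult form_pair pair_smult pair_D_smult r_distr)

text \<open>
  Testing against $(0, db)$ shows $X(b) = 0$; testing against $(Y, 0)$ gives the condition on $\nu$.
\<close>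

lemma J_iff: "(X, \<nu>) \<in> J \<longleftrightarrow> X = \<zero>\<^bsub>D\<^esub> \<and> \<nu> \<in> carrier \<Omega> \<and> (\<forall>Y\<in>carrier D. pair Y \<nu> = \<zero>)"
proof
  assume J: "(X, \<nu>) \<in> J"
  then have X: "X \<in> carrier D" and \<nu>: "\<nu> \<in> carrier \<Omega>"
    and zero: "\<And>Y \<beta>. Y \<in> carrier D \<Longrightarrow> \<beta> \<in> carrier \<Omega> \<Longrightarrow> pair Y \<nu> \<oplus> pair X \<beta> = \<zero>"
    by (auto simp: J_ideal_def E_carrier form_pair)
  have "X b = \<zero>" if "b \<in> carrier A" for b
    using zero[of "\<zero>\<^bsub>D\<^esub>" "d b"] X \<nu> that by (simp add: pair_D_zero pair_d derivation_closed)
  then have "X = \<zero>\<^bsub>D\<^esub>" using X by (auto intro: derivation_eqI simp: D_zero_apply)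
  moreover have "pair Y \<nu> = \<zero>" if "Y \<in> carrier D" for Y
    using zero[of Y "\<zero>\<^bsub>\<Omega>\<^esub>"] X \<nu> that by (simp add: pair_zero)
  ultimately show "X = \<zero>\<^bsub>D\<^esub> \<and> \<nu> \<in> carrier \<Omega> \<and> (\<forall>Y\<in>carrier D. pair Y \<nu> = \<zero>)"
    using \<nu> by blast
next
  assume "X = \<zero>\<^bsub>D\<^esub> \<and> \<nu> \<in> carrier \<Omega> \<and> (\<forall>Y\<in>carrier D. pair Y \<nu> = \<zero>)"
  then show "(X, \<nu>) \<in> J"
    by (auto simp: J_ideal_def E_carrier form_pair pair_D_zero)
qed

lemma J_subset: "J \<subseteq> carrier E"
  by (auto simp: J_ideal_def)

lemma form_J: "j \<in> J \<Longrightarrow> e \<in> carrier E \<Longrightarrow> form j e = \<zero>"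
  by (simp add: J_ideal_def)

sublocale eps: quotient_by_submodule A E J
proof (rule quotient_by_submodule.intro[OF E.module_axioms], rule E.submodule_criterion)
  have *: "form \<zero>\<^bsub>E\<^esub> e = \<zero>" if "e \<in> carrier E" for e
    using that form_smult[of \<zero> "\<zero>\<^bsub>E\<^esub>" e] by (simp add: form_closed)
  show "\<zero>\<^bsub>E\<^esub> \<in> J" by (simp add: J_ideal_def *)
qed (simp_all add: J_ideal_def form_add form_smult subset_iff)

lemma bracket_pair: "bracket (X, \<alpha>) (Y, \<beta>) =
    (commutator A X Y, (Lie X \<beta> \<ominus>\<^bsub>\<Omega>\<^esub> Lie Y \<alpha>) \<oplus>\<^bsub>\<Omega>\<^esub> d (pair Y \<alpha>))"
  by (simp add: E_bracket_def)

lemma bracket_closed: "u \<in> carrier E \<Longrightarrow> v \<in> carrier E \<Longrightarrow> bracket u v \<in> carrier E"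
  by (cases u; cases v) (simp add: E_carrier bracket_pair commutator_closed)

lemma bracket_add_left: "u \<in> carrier E \<Longrightarrow> v \<in> carrier E \<Longrightarrow> w \<in> carrier E \<Longrightarrow>
    bracket (u \<oplus>\<^bsub>E\<^esub> v) w = bracket u w \<oplus>\<^bsub>E\<^esub> bracket v w"
  by (cases u; cases v; cases w)
    (simp add: E_carrier E_add bracket_pair commutator_add Lie_add Lie_D_add pair_add d_add
      a_minus_def \<Omega>.minus_add \<Omega>.add.m_ac)

lemma bracket_add_right: "u \<in> carrier E \<Longrightarrow> v \<in> carrier E \<Longrightarrow> w \<in> carrier E \<Longrightarrow>
    bracket w (u \<oplus>\<^bsub>E\<^esub> v) = bracket w u \<oplus>\<^bsub>E\<^esub> bracket w v"
  by (cases u; cases v; cases w)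
    (simp add: E_carrier E_add bracket_pair commutator_add Lie_add Lie_D_add pair_D_add d_add
      a_minus_def \<Omega>.minus_add \<Omega>.add.m_ac)

text \<open>
  Since $[\![e,e']\!] + [\![e',e]\!] = d(e,e')$, expanding $d(fe,e')$ shows why this Leibniz rule has a
  term $(e,e')\,df$ that the rule for the second argument lacks.
\<close>

lemma bracket_smult_left:
  assumes f: "f \<in> carrier A" and u: "(X, \<alpha>) \<in> carrier E" and v: "(Y, \<beta>) \<in> carrier E"
  shows "bracket (f \<odot>\<^bsub>E\<^esub> (X, \<alpha>)) (Y, \<beta>) =
    (f \<odot>\<^bsub>E\<^esub> bracket (X, \<alpha>) (Y, \<beta>) \<oplus>\<^bsub>E\<^esub> (\<ominus> Y f) \<odot>\<^bsub>E\<^esub> (X, \<alpha>)) \<oplus>\<^bsub>E\<^esub>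
      (\<zero>\<^bsub>D\<^esub>, form (X, \<alpha>) (Y, \<beta>) \<odot>\<^bsub>\<Omega>\<^esub> d f)"
  using assms
  by (simp add: E_carrier E_add E_smult bracket_pair form_pair commutator_smult commutator_closed
      derivation_closed Lie_smult Lie_D_smult pair_smult d_mult a_minus_def \<Omega>.minus_add
      \<Omega>.smult_l_distr \<Omega>.smult_r_distr \<Omega>.smult_l_minus \<Omega>.smult_r_minus \<Omega>.add.m_ac)

lemma bracket_smult_right:
  assumes f: "f \<in> carrier A" and u: "(X, \<alpha>) \<in> carrier E" and v: "(Y, \<beta>) \<in> carrier E"
  shows "bracket (X, \<alpha>) (f \<odot>\<^bsub>E\<^esub> (Y, \<beta>)) =
    f \<odot>\<^bsub>E\<^esub> bracket (X, \<alpha>) (Y, \<beta>) \<oplus>\<^bsub>E\<^esub> X f \<odot>\<^bsub>E\<^esub> (Y, \<beta>)"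
  using assms
  by (simp add: E_carrier E_add E_smult bracket_pair commutator_smult commutator_closed
      derivation_closed Lie_smult Lie_D_smult pair_D_smult d_mult a_minus_def \<Omega>.minus_add
      \<Omega>.smult_l_distr \<Omega>.smult_r_distr \<Omega>.smult_l_minus \<Omega>.smult_r_minus \<Omega>.add.m_ac
      \<Omega>.r_neg1 \<Omega>.r_neg2 \<Omega>.r_neg \<Omega>.l_neg)

text \<open>
  A form that pairs to zero with every derivation keeps this property under Lie derivatives, by
  Cartan's relation; this is why \<open>J\<close> is an ideal.
\<close>

lemma Lie_null:
  assumes "\<nu> \<in> carrier \<Omega>" and null: "\<And>Z. Z \<in> carrier D \<Longrightarrow> pair Z \<nu> = \<zero>"
    and "X \<in> carrier D" "Y \<in> carrier D"
  shows "pair X (Lie Y \<nu>) = \<zero>"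
  using assms by (simp add: pair_Lie commutator_closed derivation_zero diff_eq_zero_iff)

lemma bracket_J:
  assumes j: "j \<in> J" and e: "e \<in> carrier E"
  shows "bracket j e \<in> J" and "bracket e j \<in> J"
proof -
  obtain \<nu> where j_eq: "j = (\<zero>\<^bsub>D\<^esub>, \<nu>)" and \<nu>: "\<nu> \<in> carrier \<Omega>"
    and null: "\<And>Z. Z \<in> carrier D \<Longrightarrow> pair Z \<nu> = \<zero>"
    using j by (cases j) (auto simp: J_iff)
  obtain Y \<beta> where e_eq: "e = (Y, \<beta>)" and Y: "Y \<in> carrier D" and \<beta>: "\<beta> \<in> carrier \<Omega>"
    using e by (cases e) (auto simp: E_carrier)
  show "bracket j e \<in> J" "bracket e j \<in> J"
    using \<nu> null Y \<beta>
    by (simp_all add: j_eq e_eq bracket_pair J_iff commutator_zero Lie_D_zero pair_D_zero d_zero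
        a_minus_def pair_add pair_minus pair_zero Lie_null)
qed


section \<open>The induced operations\<close>

abbreviation p where "p \<equiv> eps_proj k A"

lemma p_eq: "p e = J +>\<^bsub>E\<^esub> e"
  by (simp add: eps_proj_def)

lemma eps_carrier: "carrier (eps_module k A) = p ` carrier E"
  by (simp add: eps_module_def eps.carrier_quotient p_eq)

lemma p_shift: "j \<in> J \<Longrightarrow> e \<in> carrier E \<Longrightarrow> p (j \<oplus>\<^bsub>E\<^esub> e) = p e"
  using E.a_repr_independence[OF _ _ eps.N.a_subgroup, of "j \<oplus>\<^bsub>E\<^esub> e" e]
    E.a_rcosI[OF _ J_subset] by (simp add: p_eq)

lemma p_memE:
  assumes "u \<in> p e" obtains j where "j \<in> J" "u = j \<oplus>\<^bsub>E\<^esub> e"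
  using assms by (auto simp: p_eq a_r_coset_def')

lemma p_self: "e \<in> carrier E \<Longrightarrow> e \<in> p e"
  unfolding p_eq by (rule eps.N.a_rcos_self)

lemma p_eqD: "u \<in> carrier E \<Longrightarrow> p u = p v \<Longrightarrow> \<exists>j\<in>J. u = j \<oplus>\<^bsub>E\<^esub> v"
  using p_self p_memE by metis

text \<open>
  An operation that is insensitive to \<open>J\<close> takes a single value on two cosets, the one computed from any
  representatives.
\<close>

lemma induced_operation:
  assumes "u \<in> carrier E" "v \<in> carrier E"
    and inv: "\<And>i j. i \<in> J \<Longrightarrow> j \<in> J \<Longrightarrow> h (i \<oplus>\<^bsub>E\<^esub> u) (j \<oplus>\<^bsub>E\<^esub> v) = h u v"
  shows "the_elem ((\<lambda>(x, y). h x y) ` (p u \<times> p v)) = h u v"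
proof -
  have "h x y = h u v" if "x \<in> p u" "y \<in> p v" for x y
    using that inv by (elim p_memE) simp
  moreover have "u \<in> p u" "v \<in> p v" using assms(1,2) by (simp_all add: p_self)
  ultimately have "(\<lambda>(x, y). h x y) ` (p u \<times> p v) = {h u v}" by force
  then show ?thesis by simp
qed

lemma eps_form_proj:
  assumes u: "u \<in> carrier E" and v: "v \<in> carrier E"
  shows "eps_form A (p u) (p v) = form u v"
  unfolding eps_form_def
proof (rule induced_operation[OF u v])
  fix i j assume ij: "i \<in> J" "j \<in> J"
  then have c: "i \<in> carrier E" "j \<in> carrier E" using J_subset by auto
  have "form (i \<oplus>\<^bsub>E\<^esub> u) (j \<oplus>\<^bsub>E\<^esub> v) = form u (j \<oplus>\<^bsub>E\<^esub> v)"
    using ij c u v by (simp add: form_add form_J form_closed)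
  also have "\<dots> = form (j \<oplus>\<^bsub>E\<^esub> v) u" using c u v by (simp add: form_sym)
  also have "\<dots> = form v u" using ij c u v by (simp add: form_add form_J form_closed)
  finally show "form (i \<oplus>\<^bsub>E\<^esub> u) (j \<oplus>\<^bsub>E\<^esub> v) = form u v" using u v by (simp add: form_sym)
qed

lemma eps_bracket_proj:
  assumes u: "u \<in> carrier E" and v: "v \<in> carrier E"
  shows "eps_bracket k A (p u) (p v) = p (bracket u v)"
  unfolding eps_bracket_def
proof (rule induced_operation[OF u v])
  fix i j assume ij: "i \<in> J" "j \<in> J"
  then have c: "i \<in> carrier E" "j \<in> carrier E" using J_subset by auto
  have "p (bracket (i \<oplus>\<^bsub>E\<^esub> u) (j \<oplus>\<^bsub>E\<^esub> v)) = p (bracket u (j \<oplus>\<^bsub>E\<^esub> v))"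
    using ij c u v by (simp add: bracket_add_left p_shift bracket_J bracket_closed)
  also have "\<dots> = p (bracket u v)"
    using ij c u v by (simp add: bracket_add_right p_shift bracket_J bracket_closed)
  finally show "p (bracket (i \<oplus>\<^bsub>E\<^esub> u) (j \<oplus>\<^bsub>E\<^esub> v)) = p (bracket u v)" .
qed

lemma proj_submodule:
  assumes "submodule L A E"
  shows "submodule (p ` L) A (eps_module k A)"
proof -
  interpret Q: module A "eps_module k A"
    unfolding eps_module_def by (rule eps.quotient_is_module)
  have sub: "L \<subseteq> carrier E" using E.submoduleE(1)[OF assms] .
  have zero: "\<zero>\<^bsub>E\<^esub> \<in> L"
    using subgroup.one_closed[OF submodule.axioms(1)[OF assms]] by simp
  show ?thesis
  proof (rule Q.submodule_criterion)
    show "p ` L \<subseteq> carrier (eps_module k A)" using sub by (auto simp: eps_carrier)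
    show "\<zero>\<^bsub>eps_module k A\<^esub> \<in> p ` L"
      using zero by (simp add: eps_module_def eps.zero_quotient p_eq)
  next
    fix x y assume "x \<in> p ` L" "y \<in> p ` L"
    then obtain u v where uv: "u \<in> L" "v \<in> L" "x = p u" "y = p v" by blast
    then have "x \<oplus>\<^bsub>eps_module k A\<^esub> y = p (u \<oplus>\<^bsub>E\<^esub> v)"
      using subsetD[OF sub] by (simp add: eps_module_def eps.add_quotient p_eq)
    then show "x \<oplus>\<^bsub>eps_module k A\<^esub> y \<in> p ` L" using E.submoduleE(5)[OF assms] uv by simp
  next
    fix a x assume a: "a \<in> carrier A" and "x \<in> p ` L"
    then obtain u where u: "u \<in> L" "x = p u" by blast
    then have "a \<odot>\<^bsub>eps_module k A\<^esub> x = p (a \<odot>\<^bsub>E\<^esub> u)"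
      using subsetD[OF sub] a by (simp add: eps_module_def eps.smult_quotient p_eq)
    then show "a \<odot>\<^bsub>eps_module k A\<^esub> x \<in> p ` L" using E.submoduleE(4)[OF assms] u a by simp
  qed
qed

end


section \<open>The graph of a biderivation\<close>

locale biderivation_graph = k_algebra k A
  for k :: "('k, 'c) ring_scheme" and A :: "('k, 'a, 'd) module_scheme" (structure) +
  fixes br :: "'a \<Rightarrow> 'a \<Rightarrow> 'a" and \<pi> :: "('a \<Rightarrow> 'a) set \<Rightarrow> 'a \<Rightarrow> 'a"
  assumes linear: "\<pi> \<in> linear_maps A (Kaehler k A) (Der k A)"
    and \<pi>_d: "a \<in> carrier A \<Longrightarrow> \<pi> (univ_d k A a) = (\<lambda>b\<in>carrier A. br a b)"
begin

abbreviation L where "L \<equiv> L_graph k A \<pi>"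

text \<open>
  Skew-symmetry and the Jacobi identity are named separately because they correspond to the two
  separate conditions, isotropy and closure, on the graph.
\<close>

definition skew where "skew \<longleftrightarrow> (\<forall>a\<in>carrier A. \<forall>b\<in>carrier A. br a b = \<ominus> br b a)"

lemma \<pi>_closed [simp]: "\<alpha> \<in> carrier \<Omega> \<Longrightarrow> \<pi> \<alpha> \<in> carrier D"
  using linear by (auto simp: linear_maps_def)

lemma \<pi>_add: "\<alpha> \<in> carrier \<Omega> \<Longrightarrow> \<beta> \<in> carrier \<Omega> \<Longrightarrow> \<pi> (\<alpha> \<oplus>\<^bsub>\<Omega>\<^esub> \<beta>) = \<pi> \<alpha> \<oplus>\<^bsub>D\<^esub> \<pi> \<beta>"
  and \<pi>_smult: "a \<in> carrier A \<Longrightarrow> \<alpha> \<in> carrier \<Omega> \<Longrightarrow> \<pi> (a \<odot>\<^bsub>\<Omega>\<^esub> \<alpha>) = a \<odot>\<^bsub>D\<^esub> \<pi> \<alpha>"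
  using linear by (simp_all add: linear_maps_def)

lemma \<pi>_zero: "\<pi> \<zero>\<^bsub>\<Omega>\<^esub> = \<zero>\<^bsub>D\<^esub>"
  using \<pi>_smult[of \<zero> "\<zero>\<^bsub>\<Omega>\<^esub>"] by simp

lemma \<pi>_d_apply: "a \<in> carrier A \<Longrightarrow> b \<in> carrier A \<Longrightarrow> \<pi> (d a) b = br a b"
  by (simp add: \<pi>_d)

lemma br_closed [simp]: "a \<in> carrier A \<Longrightarrow> b \<in> carrier A \<Longrightarrow> br a b \<in> carrier A"
  using derivation_closed[of "\<pi> (d a)" b] by (simp add: \<pi>_d_apply)

lemma br_minus: "a \<in> carrier A \<Longrightarrow> b \<in> carrier A \<Longrightarrow> br a (\<ominus> b) = \<ominus> br a b"
  using abelian_group_hom.hom_a_inv[OF derivation_additive, of "\<pi> (d a)" b] by (simp add: \<pi>_d_apply)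

lemma graph_memI: "X = \<pi> \<alpha> \<Longrightarrow> \<alpha> \<in> carrier \<Omega> \<Longrightarrow> (X, \<alpha>) \<in> L"
  by (simp add: L_graph_def)

lemma graph_memE:
  assumes "u \<in> L" obtains \<alpha> where "\<alpha> \<in> carrier \<Omega>" "u = (\<pi> \<alpha>, \<alpha>)"
  using assms by (auto simp: L_graph_def)

lemma graph_submodule: "submodule L A E"
proof (rule E.submodule_criterion)
  show "L \<subseteq> carrier E" by (auto simp: E_carrier elim: graph_memE)
  show "\<zero>\<^bsub>E\<^esub> \<in> L" by (simp add: E_zero graph_memI \<pi>_zero)
next
  fix u v assume "u \<in> L" "v \<in> L"
  then show "u \<oplus>\<^bsub>E\<^esub> v \<in> L" by (auto elim!: graph_memE simp: E_add \<pi>_add intro!: graph_memI)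
next
  fix a u assume "a \<in> carrier A" "u \<in> L"
  then show "a \<odot>\<^bsub>E\<^esub> u \<in> L" by (auto elim!: graph_memE simp: E_smult \<pi>_smult intro!: graph_memI)
qed

lemmas graph_subset = E.submoduleE(1)[OF graph_submodule]
  and graph_smult = E.submoduleE(4)[OF graph_submodule]
  and graph_add = E.submoduleE(5)[OF graph_submodule]

text \<open>
  Both sides are biadditive, so that the identity reduces to $\alpha = a\,da'$ and $\beta = b\,db'$, where
  it is skew-symmetry multiplied by the coefficients.
\<close>

lemma skew_imp_pair_skew:
  assumes skew and \<alpha>: "\<alpha> \<in> carrier \<Omega>" and \<beta>: "\<beta> \<in> carrier \<Omega>"
  shows "pair (\<pi> \<beta>) \<alpha> = \<ominus> pair (\<pi> \<alpha>) \<beta>"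
  using \<alpha>
proof (induction rule: kaehler_induct)
  case (generator a a')
  show ?case using \<beta>
  proof (induction rule: kaehler_induct)
    case (generator b b')
    have "br b' a' = \<ominus> br a' b'"
      using \<open>skew\<close> \<open>a' \<in> carrier A\<close> \<open>b' \<in> carrier A\<close> unfolding skew_def by blast
    then show ?case using generator \<open>a \<in> carrier A\<close> \<open>a' \<in> carrier A\<close>
      by (simp add: \<pi>_smult pair_generator D_smult_apply \<pi>_d_apply r_minus m_lcomm)
  next
    case (add \<beta>\<^sub>1 \<beta>\<^sub>2)
    then show ?case using \<open>a \<in> carrier A\<close> \<open>a' \<in> carrier A\<close>
      by (simp add: \<pi>_add pair_D_add pair_add minus_add a_comm)
  qed
next
  case (add \<alpha>\<^sub>1 \<alpha>\<^sub>2)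
  then show ?case using \<beta> by (simp add: \<pi>_add pair_D_add pair_add minus_add a_comm)
qed

lemma skew_iff_form_zero: "skew \<longleftrightarrow> (\<forall>u\<in>L. \<forall>v\<in>L. form u v = \<zero>)"
proof
  assume skew
  then have "pair (\<pi> \<beta>) \<alpha> \<oplus> pair (\<pi> \<alpha>) \<beta> = \<zero>" if "\<alpha> \<in> carrier \<Omega>" "\<beta> \<in> carrier \<Omega>" for \<alpha> \<beta>
    using that by (subst skew_imp_pair_skew) (simp_all add: l_neg)
  then show "\<forall>u\<in>L. \<forall>v\<in>L. form u v = \<zero>"
    by (intro ballI; elim graph_memE) (simp add: form_pair)
next
  assume zero: "\<forall>u\<in>L. \<forall>v\<in>L. form u v = \<zero>"
  show skew unfolding skew_def
  proof (intro ballI)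
    fix a b assume ab: "a \<in> carrier A" "b \<in> carrier A"
    have "form (\<pi> (d b), d b) (\<pi> (d a), d a) = \<zero>" using zero ab by (simp add: graph_memI)
    then have "br a b \<oplus> br b a = \<zero>" using ab by (simp add: form_pair pair_d \<pi>_d_apply)
    then show "br a b = \<ominus> br b a" using ab by (intro minus_equality[symmetric]) simp_all
  qed
qed

text \<open>
  Orthogonality to the element of the graph over $db$ reads
  $\langle\tilde\pi(db),\alpha\rangle + X(b) = 0$, and the first term equals $-\tilde\pi(\alpha)(b)$.
\<close>

lemma graph_maximal:
  assumes skew and e: "e \<in> carrier E" and orth: "\<And>l. l \<in> L \<Longrightarrow> form e l = \<zero>"
  shows "e \<in> L"
proof -
  obtain X \<alpha> where e_eq: "e = (X, \<alpha>)" and X: "X \<in> carrier D" and \<alpha>: "\<alpha> \<in> carrier \<Omega>"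
    using e by (cases e) (auto simp: E_carrier)
  have "X b = \<pi> \<alpha> b" if b: "b \<in> carrier A" for b
  proof -
    have "form e (\<pi> (d b), d b) = \<zero>" using b by (intro orth graph_memI) simp_all
    then have "\<ominus> \<pi> \<alpha> b \<oplus> X b = \<zero>"
      using b X \<alpha> skew_imp_pair_skew[OF \<open>skew\<close> \<alpha>, of "d b"] by (simp add: e_eq form_pair pair_d)
    moreover have cl: "X b \<in> carrier A" "\<pi> \<alpha> b \<in> carrier A"
      using b X \<alpha> by (simp_all add: derivation_closed)
    ultimately have "X b \<ominus> \<pi> \<alpha> b = \<zero>" by (simp add: a_minus_def a_comm)
    then show ?thesis using cl by (simp add: diff_eq_zero_iff)
  qed
  then have "X = \<pi> \<alpha>" using X \<alpha> by (intro derivation_eqI) simp_all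
  then show ?thesis using \<alpha> by (simp add: e_eq graph_memI)
qed

text \<open>
  In the second component $d\{a,b\} - d\{b,a\} + d\{b,a\}$ the last two terms, one from a Lie
  derivative and one from the pairing, cancel.
\<close>

lemma bracket_generators:
  assumes "a \<in> carrier A" "b \<in> carrier A"
  shows "bracket (\<pi> (d a), d a) (\<pi> (d b), d b) = (commutator A (\<pi> (d a)) (\<pi> (d b)), d (br a b))"
  using assms
  by (simp add: bracket_pair Lie_d pair_d \<pi>_d_apply a_minus_def \<Omega>.add.m_assoc \<Omega>.l_neg)

definition jacobi where "jacobi \<longleftrightarrow> (\<forall>a\<in>carrier A. \<forall>b\<in>carrier A. \<forall>c\<in>carrier A.
    br a (br b c) \<oplus> br b (br c a) \<oplus> br c (br a b) = \<zero>)"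

text \<open>
  For a skew-symmetric bracket the Jacobi identity says that $a \mapsto \{a,\cdot\}$ turns brackets into
  commutators.
\<close>

lemma jacobi_iff_commutator:
  assumes skew
  shows "jacobi \<longleftrightarrow> (\<forall>a\<in>carrier A. \<forall>b\<in>carrier A.
    commutator A (\<pi> (d a)) (\<pi> (d b)) = \<pi> (d (br a b)))"
proof -
  have swap: "br x y = \<ominus> br y x" if "x \<in> carrier A" "y \<in> carrier A" for x y
    using \<open>skew\<close> that unfolding skew_def by blast
  have "(commutator A (\<pi> (d a)) (\<pi> (d b)) = \<pi> (d (br a b))) \<longleftrightarrow>
      (\<forall>c\<in>carrier A. br a (br b c) \<oplus> br b (br c a) \<oplus> br c (br a b) = \<zero>)"
    if ab: "a \<in> carrier A" "b \<in> carrier A" for a b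
  proof -
    have "(commutator A (\<pi> (d a)) (\<pi> (d b)) = \<pi> (d (br a b))) \<longleftrightarrow>
        (\<forall>c\<in>carrier A. commutator A (\<pi> (d a)) (\<pi> (d b)) c = \<pi> (d (br a b)) c)"
      using ab by (metis derivation_eqI commutator_closed \<pi>_closed d_closed br_closed)
    also have "\<dots> \<longleftrightarrow> (\<forall>c\<in>carrier A. br a (br b c) \<ominus> br b (br a c) = br (br a b) c)"
      using ab by (simp add: commutator_apply \<pi>_d_apply)
    also have "\<dots> \<longleftrightarrow> (\<forall>c\<in>carrier A. br a (br b c) \<oplus> br b (br c a) \<oplus> br c (br a b) = \<zero>)"
    proof (intro ball_cong refl)
      fix c assume c: "c \<in> carrier A"
      have "br b (br c a) = \<ominus> br b (br a c)" using ab c swap[of c a] by (simp add: br_minus)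
      moreover have "br c (br a b) = \<ominus> br (br a b) c" using ab c by (intro swap) simp_all
      ultimately have "br a (br b c) \<oplus> br b (br c a) \<oplus> br c (br a b) =
          (br a (br b c) \<ominus> br b (br a c)) \<ominus> br (br a b) c"
        by (simp add: a_minus_def)
      then show "br a (br b c) \<ominus> br b (br a c) = br (br a b) c \<longleftrightarrow>
          br a (br b c) \<oplus> br b (br c a) \<oplus> br c (br a b) = \<zero>"
        using ab c by (simp add: diff_eq_zero_iff)
    qed
    finally show ?thesis .
  qed
  then show ?thesis unfolding jacobi_def by blast
qed

text \<open>
  Both Leibniz rules of the Courant bracket keep its value in the submodule \<open>L\<close>: the derivative terms
  are multiples of elements of \<open>L\<close>, and the anomalous term carries the form as a factor, which vanishes
  on \<open>L\<close>. So closure spreads from exact forms, first in the second argument, then in the first.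
\<close>

lemma graph_closed:
  assumes skew jacobi and u: "u \<in> L" and v: "v \<in> L"
  shows "bracket u v \<in> L"
proof -
  have form_zero: "form x y = \<zero>" if "x \<in> L" "y \<in> L" for x y
    using \<open>skew\<close> that by (simp add: skew_iff_form_zero)
  have in_E: "x \<in> carrier E" if "x \<in> L" for x using that graph_subset by blast
  have gen_gen: "bracket (\<pi> (d a), d a) (\<pi> (d b), d b) \<in> L"
    if ab: "a \<in> carrier A" "b \<in> carrier A" for a b
    using ab assms by (simp add: bracket_generators jacobi_iff_commutator graph_memI)
  have gen_any: "bracket (\<pi> (d a), d a) (\<pi> \<beta>, \<beta>) \<in> L"
    if a: "a \<in> carrier A" and \<beta>: "\<beta> \<in> carrier \<Omega>" for a \<beta>
    using \<beta>
  proof (induction rule: kaehler_induct)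
    case (generator b c)
    let ?x = "(\<pi> (d a), d a)" and ?y = "(\<pi> (d c), d c)"
    have xy: "?x \<in> L" "?y \<in> L" using a generator by (simp_all add: graph_memI)
    have "(\<pi> (b \<odot>\<^bsub>\<Omega>\<^esub> d c), b \<odot>\<^bsub>\<Omega>\<^esub> d c) = b \<odot>\<^bsub>E\<^esub> ?y"
      using generator by (simp add: \<pi>_smult E_smult)
    then have "bracket ?x (\<pi> (b \<odot>\<^bsub>\<Omega>\<^esub> d c), b \<odot>\<^bsub>\<Omega>\<^esub> d c) =
        b \<odot>\<^bsub>E\<^esub> bracket ?x ?y \<oplus>\<^bsub>E\<^esub> \<pi> (d a) b \<odot>\<^bsub>E\<^esub> ?y"
      using generator xy by (simp only: bracket_smult_right in_E)
    then show ?case using a generator xy gen_gen by (simp add: graph_add graph_smult \<pi>_d_apply)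
  next
    case (add \<beta>\<^sub>1 \<beta>\<^sub>2)
    have "bracket (\<pi> (d a), d a) ((\<pi> \<beta>\<^sub>1, \<beta>\<^sub>1) \<oplus>\<^bsub>E\<^esub> (\<pi> \<beta>\<^sub>2, \<beta>\<^sub>2)) \<in> L"
      using a add by (subst bracket_add_right) (simp_all add: E_carrier graph_add)
    then show ?case using add by (simp add: E_add \<pi>_add)
  qed
  have any_any: "bracket (\<pi> \<alpha>, \<alpha>) (\<pi> \<beta>, \<beta>) \<in> L"
    if \<alpha>: "\<alpha> \<in> carrier \<Omega>" and \<beta>: "\<beta> \<in> carrier \<Omega>" for \<alpha> \<beta>
    using \<alpha>
  proof (induction rule: kaehler_induct)
    case (generator b c)
    let ?x = "(\<pi> (d c), d c)" and ?y = "(\<pi> \<beta>, \<beta>)"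
    have xy: "?x \<in> L" "?y \<in> L" using \<beta> generator by (simp_all add: graph_memI)
    have Yb: "\<ominus> \<pi> \<beta> b \<in> carrier A" using \<beta> generator by (simp add: derivation_closed)
    have "(\<pi> (b \<odot>\<^bsub>\<Omega>\<^esub> d c), b \<odot>\<^bsub>\<Omega>\<^esub> d c) = b \<odot>\<^bsub>E\<^esub> ?x"
      using generator by (simp add: \<pi>_smult E_smult)
    then have "bracket (\<pi> (b \<odot>\<^bsub>\<Omega>\<^esub> d c), b \<odot>\<^bsub>\<Omega>\<^esub> d c) ?y =
        (b \<odot>\<^bsub>E\<^esub> bracket ?x ?y \<oplus>\<^bsub>E\<^esub> (\<ominus> \<pi> \<beta> b) \<odot>\<^bsub>E\<^esub> ?x) \<oplus>\<^bsub>E\<^esub>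
          (\<zero>\<^bsub>D\<^esub>, form ?x ?y \<odot>\<^bsub>\<Omega>\<^esub> d b)"
      using generator xy by (simp only: bracket_smult_left in_E)
    moreover have "(\<zero>\<^bsub>D\<^esub>, form ?x ?y \<odot>\<^bsub>\<Omega>\<^esub> d b) \<in> L"
      using generator xy by (simp add: form_zero graph_memI \<pi>_zero)
    moreover have "bracket ?x ?y \<in> L" using generator \<beta> by (simp add: gen_any)
    ultimately show ?case using generator xy Yb by (simp only: graph_add graph_smult)
  next
    case (add \<alpha>\<^sub>1 \<alpha>\<^sub>2)
    have "bracket ((\<pi> \<alpha>\<^sub>1, \<alpha>\<^sub>1) \<oplus>\<^bsub>E\<^esub> (\<pi> \<alpha>\<^sub>2, \<alpha>\<^sub>2)) (\<pi> \<beta>, \<beta>) \<in> L"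
      using \<beta> add by (subst bracket_add_left) (simp_all add: E_carrier graph_add)
    then show ?case using add by (simp add: E_add \<pi>_add)
  qed
  show ?thesis using u v any_any by (elim graph_memE) simp
qed

text \<open>
  Closure is known only modulo \<open>J\<close>. An element of \<open>J\<close> has zero derivation part, so the commutator is
  exactly $\tilde\pi(\gamma)$ for some $\gamma$; the null form $\nu$ by which $\gamma$ differs from
  $d\{a,b\}$ is annihilated by $\tilde\pi$.
\<close>

lemma closed_imp_jacobi:
  assumes skew and closed: "\<And>u v. u \<in> L \<Longrightarrow> v \<in> L \<Longrightarrow> p (bracket u v) \<in> p ` L"
  shows jacobi
proof -
  have "commutator A (\<pi> (d a)) (\<pi> (d b)) = \<pi> (d (br a b))"
    if ab: "a \<in> carrier A" "b \<in> carrier A" for a b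
  proof -
    let ?X = "commutator A (\<pi> (d a)) (\<pi> (d b))"
    have "p (bracket (\<pi> (d a), d a) (\<pi> (d b), d b)) \<in> p ` L"
      using ab by (intro closed graph_memI) simp_all
    then obtain \<gamma> where \<gamma>: "\<gamma> \<in> carrier \<Omega>" and "p (?X, d (br a b)) = p (\<pi> \<gamma>, \<gamma>)"
      using ab by (auto simp: bracket_generators elim!: graph_memE)
    moreover have "(?X, d (br a b)) \<in> carrier E" using ab by (simp add: E_carrier commutator_closed)
    ultimately obtain j where "j \<in> J" "(?X, d (br a b)) = j \<oplus>\<^bsub>E\<^esub> (\<pi> \<gamma>, \<gamma>)"
      using p_eqD by metis
    then obtain \<nu> where \<nu>: "\<nu> \<in> carrier \<Omega>" "\<And>Y. Y \<in> carrier D \<Longrightarrow> pair Y \<nu> = \<zero>"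
      and X: "?X = \<pi> \<gamma>" and d_eq: "d (br a b) = \<nu> \<oplus>\<^bsub>\<Omega>\<^esub> \<gamma>"
      using \<gamma> by (cases j) (auto simp: J_iff E_add)
    have "\<pi> \<nu> c = \<zero>" if "c \<in> carrier A" for c
      using skew_imp_pair_skew[OF \<open>skew\<close> _ \<nu>(1), of "d c"] \<nu> that by (simp add: pair_d)
    then have "\<pi> \<nu> = \<zero>\<^bsub>D\<^esub>" using \<nu> by (intro derivation_eqI) (simp_all add: D_zero_apply)
    then show ?thesis using \<nu> \<gamma> by (simp add: X d_eq \<pi>_add)
  qed
  then show ?thesis using \<open>skew\<close> by (simp add: jacobi_iff_commutator)
qed

theorem dirac_iff: "dirac_structure k A (p ` L) \<longleftrightarrow> skew \<and> jacobi"
proof -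
  have in_E: "x \<in> carrier E" if "x \<in> L" for x using that graph_subset by blast
  have iso: "isotropic k A (p ` L) \<longleftrightarrow> skew"
    using proj_submodule[OF graph_submodule]
    by (simp add: isotropic_def eps_form_proj in_E skew_iff_form_zero)
  have max: "maximally_isotropic k A (p ` L) \<longleftrightarrow> skew"
  proof
    assume skew
    have "x \<in> p ` L" if x: "x \<in> carrier (eps_module k A)"
      and orth: "\<forall>l\<in>p ` L. eps_form A x l = \<zero>" for x
    proof -
      obtain e where e: "e \<in> carrier E" "x = p e" using x by (auto simp: eps_carrier)
      then have "form e l = \<zero>" if "l \<in> L" for l
        using orth that by (simp add: eps_form_proj in_E)
      then show ?thesis using graph_maximal[OF \<open>skew\<close> e(1)] e(2) by blast
    qed
    then show "maximally_isotropic k A (p ` L)"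
      using iso \<open>skew\<close> by (simp add: maximally_isotropic_def)
  qed (simp add: maximally_isotropic_def iso)
  have "(\<forall>l\<in>p ` L. \<forall>l'\<in>p ` L. eps_bracket k A l l' \<in> p ` L) \<longleftrightarrow>
      (\<forall>u\<in>L. \<forall>v\<in>L. p (bracket u v) \<in> p ` L)"
    by (simp add: eps_bracket_proj in_E)
  also have "\<dots> \<longleftrightarrow> jacobi" if skew
    using closed_imp_jacobi[OF that] graph_closed[OF that] by blast
  finally show ?thesis using max unfolding dirac_structure_def by blast
qed

end

theorem proposition4p11:
  fixes k :: "('k, 'c) ring_scheme" and A :: "('k, 'a, 'd) module_scheme"
    and br :: "'a \<Rightarrow> 'a \<Rightarrow> 'a" and pt :: "('a \<Rightarrow> 'a) set \<Rightarrow> 'a \<Rightarrow> 'a"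
  assumes "algebra k A"
    and "carrier (eps_module k A) \<noteq> {\<zero>\<^bsub>eps_module k A\<^esub>}"
    and "k_bilinear k A br" and "biderivation k A br"
    and "pt \<in> linear_maps A (Kaehler k A) (Der k A)"
    and "\<And>a. a \<in> carrier A \<Longrightarrow> pt (univ_d k A a) = (\<lambda>b\<in>carrier A. br a b)"
  shows "poisson_bracket k A br \<longleftrightarrow> dirac_structure k A (eps_proj k A ` L_graph k A pt)"
proof -
  interpret k_algebra k A
    by (intro k_algebra.intro k_algebra_axioms.intro algebra.M_cring[OF assms(1)] assms(1))
  interpret biderivation_graph k A br pt
    by unfold_locales (use assms(5,6) in simp_all)
  show ?thesis
    using assms(3,4) by (simp add: poisson_bracket_def dirac_iff skew_def jacobi_def)
qed

end
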